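(* Let $\lambda$ be a dominant integral weight of $\mathfrak g$ and write $a=\langle\lambda,\check\alpha_1\rangle$, $b=\langle\lambda,\check\alpha_2\rangle$. Let $\boldsymbol l_0=(0,0)$, $\boldsymbol l_1=(0,1)$, $\boldsymbol l_2=(1,1)$, $\boldsymbol l_3=(1,2)$, $\boldsymbol l_4=(1,3)$, $\boldsymbol l_5=(2,3)$, $\boldsymbol l_6=(2,4)$. Let $i\in\{0,1,\dots,6\}$ and suppose that $\boldsymbol l_i=(l_1,l_2)$ is admissible, i.e. that $V_{\lambda+\omega_2-l_1\alpha_1-l_2\alpha_2}$ is isomorphic to a submodule of $V_\lambda\otimes V_{\omega_2}$. Then the pair of polynomials $(y_1^{(i)},y_2^{(i)})$ given below represents a solution of the Bethe ansatz equation associated to $\boldsymbol\Lambda=(\lambda,\omega_2)$, $\boldsymbol z=(0,1)$ and $\boldsymbol l_i$. $i=0$: $y_1^{(0)}=1$, $y_2^{(0)}=1$. $i=1$: $y_1^{(1)}=1$, $y_2^{(1)}=x-\frac{b}{b+1}$. $i=2$: $y_1^{(2)}=x-\frac{a(3a+b+3)}{(a+1)(3a+b+4)}$, $\ y_2^{(2)}=x-\frac{3a+b+3}{3a+b+4}$. $i=3$: $y_1^{(3)}=x-\frac{(3a+b+3)(3a+2b+4)}{(3a+b+5)(3a+2b+6)}$, $$y_2^{(3)}=x^2-\frac{2(3a+2b+4)(3a+5b+3ab+b^2+6)}{(b+2)(3a+b+5)(3a+2b+6)}x+\frac{b(3a+b+3)(3a+2b+4)^2}{(b+2)(3a+b+5)(3a+2b+6)^2}.$$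 $i=4$: $y_1^{(4)}=x-\frac{(a+b+1)(3a+2b+4)}{(a+b+2)(3a+2b+5)}$, $$y_2^{(4)}=x^3-\frac{3(a+b+1)(3ab+2b^2-2a+3b-2)}{b(a+b+2)(3a+2b+5)}x^2+\frac{3(b-1)(a+b+1)^2(3a+2b+4)(3ab+2b^2+2a+6b+4)}{b(b+1)(a+b+2)^2(3a+2b+5)^2}x-\frac{(b-1)(a+b+1)^3(3a+2b+4)^2}{(b+1)(a+b+2)^3(3a+2b+5)^2}.$$ $i=5$: $$y_1^{(5)}=x^2-\frac{2(2a+b+2)(3a+b+2)(3a^2+2ab+6a+b+3)}{(a+1)(2a+b+3)(3a+b+3)(3a+2b+5)}x+\frac{a(2a+b+2)^2(3a+b+2)(3a+2b+4)}{(a+1)(2a+b+3)^2(3a+b+4)(3a+2b+5)},$$ $$y_2^{(5)}=x^3-\frac{3(2a+b+2)(9a^2+9ab+2b^2+20a+9b+11)}{(2a+b+3)(3a+b+3)(3a+2b+5)}x^2+\frac{3(3a+b+2)(2a+b+2)^2(3a+2b+4)(9a^2+9ab+2b^2+25a+12b+18)}{(2a+b+3)^2(3a+b+3)(3a+b+4)(3a+2b+5)^2}x-\frac{(2a+b+2)^3(3a+b+2)(3a+2b+4)^2}{(2a+b+3)^3(3a+b+4)(3a+2b+5)^2}.$$ $i=6$: $$y_1^{(6)}=x^2-\frac{2(2a+b+2)(3a+2b+3)(3a^2+4ab+b^2+8a+5b+6)}{(a+b+2)(2a+b+3)(3a+b+4)(3a+2b+4)}x+\frac{(a+b+1)(2a+b+2)^2(3a+b+3)(3a+2b+3)}{(a+b+2)(2a+b+3)^2(3a+b+4)(3a+2b+5)},$$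 $$y_2^{(6)}=x^4-c_3x^3+c_2x^2-c_1x+c_0,$$ where $$c_3=\frac{2P_3}{(b+1)(a+b+2)(2a+b+3)(3a+b+4)(3a+2b+4)},$$ $$P_3=9a^4(4b+3)+3a^3(30b^2+78b+47)+a^2(80b^3+372b^2+562b+270)+a(30b^4+208b^3+528b^2+578b+228)+2(b+2)^2(2b^3+11b^2+18b+9),$$ $$c_2=\frac{6(1+a+b)(2+2a+b)(3+3a+2b)\,P_2}{(b+1)(a+b+2)^2(2a+b+3)^2(3a+b+4)(3a+2b+4)^2(3a+2b+5)},$$ $$P_2=27a^5(1+2b)+3a^4(70+147b+57b^2)+3a^3(215+493b+333b^2+70b^3)+2(2+b)^2(27+60b+47b^2+16b^3+2b^4)+a^2(978+2498b+2263b^2+880b^3+125b^4)+2a(366+1049b+1165b^2+634b^3+170b^4+18b^5),$$ $$c_1=\frac{2(1+a+b)^2(2+2a+b)^2(3+3a+2b)^2\,P_1}{(1+b)(2+a+b)^3(3+2a+b)^3(4+3a+b)(4+3a+2b)(5+3a+2b)},$$ $$P_1=3a^3(1+4b)+2(2+b)^2(3+4b+b^2)+2a^2(9+28b+11b^2)+2a(18+47b+31b^2+6b^3),$$ $$c_0=\frac{b(a+b+1)^3(2a+b+2)^3(3a+b+3)(3a+2b+3)^2}{(b+1)(a+b+2)^3(2a+b+3)^3(3a+b+4)(3a+2b+5)^2}.$$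
   Context: $\mathfrak g$ is the complex simple Lie algebra of type G$_2$ with Cartan matrix $(a_{i,j})=\begin{pmatrix}2&-1\\-3&2\end{pmatrix}$, Cartan subalgebra $\mathfrak h$, simple roots $\alpha_1$ (long), $\alpha_2$ (short) in $\mathfrak h^*$ and simple coroots $\check\alpha_1,\check\alpha_2\in\mathfrak h$, with $\langle\alpha_j,\check\alpha_i\rangle=a_{i,j}$. The bilinear form on $\mathfrak h^*$ is normalized by $(\alpha_1,\alpha_1)=6$, $(\alpha_1,\alpha_2)=-3$, $(\alpha_2,\alpha_2)=2$, and $\langle\lambda,\check\alpha_i\rangle=2(\lambda,\alpha_i)/(\alpha_i,\alpha_i)$. The fundamental weights satisfy $\langle\omega_j,\check\alpha_i\rangle=\delta_{i,j}$. A weight $\lambda$ is dominant integral if $\langle\lambda,\check\alpha_i\rangle\in\mathbb Z_{\geq0}$ for $i=1,2$. $V_\lambda$ is the irreducible $\mathfrak g$-module of highest weight $\lambda$ ($\dim V_{\omega_2}=7$). Bethe ansatz equation: for weights $\boldsymbol\Lambda=(\lambda^{(1)},\dots,\lambda^{(n)})$, distinct complex numbers $\boldsymbol z=(z_1,\dots,z_n)$ and $\boldsymbol l=(l_1,l_2)\in\mathbb Z_{\geq0}^2$, the Bethe ansatz equation associated to $\boldsymbol\Lambda,\boldsymbol z,\boldsymbol l$ is the system for complex variables $\boldsymbol t=(t^{(1)}_1,\dots,t^{(1)}_{l_1};t^{(2)}_1,\dots,t^{(2)}_{l_2})$: $$-\sum_{s=1}^n\frac{(\lambda^{(s)},\alpha_1)}{t_i^{(1)}-z_s}-\sum_{k=1}^{l_2}\frac{3}{t_i^{(1)}-t_k^{(2)}}+\sum_{k\ne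 i}\frac{6}{t_i^{(1)}-t_k^{(1)}}=0,\quad 1\le i\le l_1,$$ $$-\sum_{s=1}^n\frac{(\lambda^{(s)},\alpha_2)}{t_i^{(2)}-z_s}-\sum_{k=1}^{l_1}\frac{3}{t_i^{(2)}-t_k^{(1)}}+\sum_{k\ne i}\frac{2}{t_i^{(2)}-t_k^{(2)}}=0,\quad 1\le i\le l_2.$$ By definition, for a solution all $t_i^{(j)}$ are distinct, and $t_i^{(j)}\neq z_s$ whenever $(\lambda^{(s)},\alpha_j)\ne0$. A pair $(y_1,y_2)$ represents a solution $\boldsymbol t$ if $y_j(x)=\prod_{i=1}^{l_j}(x-t_i^{(j)})$, $j=1,2$. *)

theory Defs
  imports
    "HOL-Analysis.Analysis"
    "HOL-Library.Function_Algebras"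
    "HOL-Computational_Algebra.Polynomial"
begin

text \<open>The dual of the Cartan subalgebra is identified with \<open>complex ^ 2\<close> through the basis of
  simple roots: \<open>\<lambda>\<close> stands for \<open>\<lambda>$1 \<alpha>\<^sub>1 + \<lambda>$2 \<alpha>\<^sub>2\<close>.\<close>

type_synonym weight = "complex ^ 2"

definition cartan :: "complex ^ 2 ^ 2" where
  "cartan = vector [vector [2, -1], vector [-3, 2]]"

definition simple_root :: "2 \<Rightarrow> weight" where
  "simple_root i = axis i 1"

text \<open>\<open>pairing \<lambda> i\<close> is \<open>\<langle>\<lambda>, \<alpha>\<^sub>i\<^sup>\<or>\<rangle>\<close>, the linear extension of \<open>\<langle>\<alpha>\<^sub>j, \<alpha>\<^sub>i\<^sup>\<or>\<rangle> = a\<^sub>i\<^sub>j\<close>.\<close>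

definition pairing :: "weight \<Rightarrow> 2 \<Rightarrow> complex" where
  "pairing lam i = (cartan *v lam) $ i"

definition gram :: "complex ^ 2 ^ 2" where
  "gram = vector [vector [6, -3], vector [-3, 2]]"

definition weight_form :: "weight \<Rightarrow> weight \<Rightarrow> complex" where
  "weight_form lam \<mu> = (\<Sum>i\<in>UNIV. \<Sum>j\<in>UNIV. lam $ i * gram $ i $ j * \<mu> $ j)"

definition fund_weight :: "2 \<Rightarrow> weight" where
  "fund_weight j = (THE \<omega>. \<forall>i. pairing \<omega> i = (if i = j then 1 else 0))"

definition dominant_integral :: "weight \<Rightarrow> bool" where
  "dominant_integral lam \<longleftrightarrow> (\<forall>i. \<exists>m::nat. pairing lam i = of_nat m)"

lemma pairing_1: "pairing lam 1 = 2 * lam $ 1 - lam $ 2"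
  and pairing_2: "pairing lam 2 = 2 * lam $ 2 - 3 * lam $ 1"
  by (simp_all add: pairing_def cartan_def matrix_vector_mult_def sum_2)

lemma pairing_simple_root: "pairing (simple_root j) i = cartan $ i $ j"
  by (simp add: pairing_def simple_root_def matrix_vector_mult_def axis_def if_distrib cong: if_cong)

lemma weight_form_expand:
  "weight_form lam \<mu> = 6 * lam $ 1 * \<mu> $ 1 - 3 * lam $ 1 * \<mu> $ 2 - 3 * lam $ 2 * \<mu> $ 1 + 2 * lam $ 2 * \<mu> $ 2"
  by (simp add: weight_form_def gram_def sum_2 algebra_simps)

lemma weight_form_simple_roots:
  "weight_form (simple_root 1) (simple_root 1) = 6"
  "weight_form (simple_root 1) (simple_root 2) = -3"
  "weight_form (simple_root 2) (simple_root 2) = 2"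
  by (simp_all add: weight_form_expand simple_root_def axis_def)

lemma pairing_eq_weight_form:
  "pairing lam i = 2 * weight_form lam (simple_root i) / weight_form (simple_root i) (simple_root i)"
  using exhaust_2[of i]
  by (auto simp: pairing_1 pairing_2 weight_form_expand simple_root_def axis_def field_simps)

lemma weight_eqI: "pairing lam 1 = pairing \<mu> 1 \<Longrightarrow> pairing lam 2 = pairing \<mu> 2 \<Longrightarrow> lam = \<mu>"
  by (simp add: vec_eq_iff forall_2 pairing_1 pairing_2) algebra

lemma pairing_fund_weight: "pairing (fund_weight j) i = (if i = j then 1 else 0)"
proof -
  have "\<exists>\<omega>. \<forall>i. pairing \<omega> i = (if i = j then 1 else 0)"
    using exhaust_2[of j]
  proof
    assume "j = 1"
    then show ?thesis
      by (intro exI[of _ "vector [2, 3]"]) (simp add: forall_2 pairing_1 pairing_2)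
  next
    assume "j = 2"
    then show ?thesis
      by (intro exI[of _ "vector [1, 2]"]) (simp add: forall_2 pairing_1 pairing_2)
  qed
  then have "\<exists>!\<omega>. \<forall>i. pairing \<omega> i = (if i = j then 1 else 0)"
    by (metis (no_types, lifting) weight_eqI)
  from theI'[OF this] show ?thesis
    by (simp add: fund_weight_def)
qed

locale lie_algebra = vector_space scale
  for scale :: "complex \<Rightarrow> 'g::ab_group_add \<Rightarrow> 'g" +
  fixes bracket :: "'g \<Rightarrow> 'g \<Rightarrow> 'g"
  assumes bracket_linear_left: "Vector_Spaces.linear scale scale (\<lambda>x. bracket x y)"
    and bracket_linear_right: "Vector_Spaces.linear scale scale (bracket x)"
    and bracket_alternating: "bracket x x = 0"
    and jacobi: "bracket x (bracket y z) + bracket y (bracket z x) + bracket z (bracket x y) = 0"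
begin

definition lie_ideal :: "'g set \<Rightarrow> bool" where
  "lie_ideal I \<longleftrightarrow> subspace I \<and> (\<forall>x. \<forall>y\<in>I. bracket x y \<in> I)"

definition lie_subalgebra :: "'g set \<Rightarrow> bool" where
  "lie_subalgebra S \<longleftrightarrow> subspace S \<and> (\<forall>x\<in>S. \<forall>y\<in>S. bracket x y \<in> S)"

definition lie_simple :: bool where
  "lie_simple \<longleftrightarrow> (\<exists>x y. bracket x y \<noteq> 0) \<and> (\<forall>I. lie_ideal I \<longrightarrow> I = {0} \<or> I = UNIV)"

end

text \<open>The finite-dimensional simple Lie algebra with the Cartan matrix above, together with
  Chevalley generators \<open>e i\<close>, \<open>f i\<close> of weights \<open>\<alpha>\<^sub>i\<close>, \<open>-\<alpha>\<^sub>i\<close> and simple coroots \<open>h i\<close>; its Cartan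
  subalgebra is the span of \<open>h 1\<close>, \<open>h 2\<close>. By simplicity these data are determined up to isomorphism
  (the Serre relations hold automatically).\<close>

locale g2_lie_algebra = lie_algebra scale bracket
  for scale :: "complex \<Rightarrow> 'g::ab_group_add \<Rightarrow> 'g" and bracket +
  fixes e f h :: "2 \<Rightarrow> 'g"
  assumes finite_dim: "\<exists>B. finite B \<and> span B = UNIV"
    and simple: lie_simple
    and bracket_hh: "bracket (h i) (h j) = 0"
    and bracket_he: "bracket (h i) (e j) = scale (pairing (simple_root j) i) (e j)"
    and bracket_hf: "bracket (h i) (f j) = scale (- pairing (simple_root j) i) (f j)"
    and bracket_ef: "bracket (e i) (f j) = (if i = j then h i else 0)"
    and generated: "lie_subalgebra S \<Longrightarrow> range e \<subseteq> S \<Longrightarrow> range f \<subseteq> S \<Longrightarrow> range h \<subseteq> S \<Longrightarrow> S = UNIV"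

locale lie_module = lie_algebra scale bracket + M: vector_space mscale
  for scale :: "complex \<Rightarrow> 'g::ab_group_add \<Rightarrow> 'g" and bracket
    and mscale :: "complex \<Rightarrow> 'v::ab_group_add \<Rightarrow> 'v" +
  fixes act :: "'g \<Rightarrow> 'v \<Rightarrow> 'v"
  assumes act_linear_left: "Vector_Spaces.linear scale mscale (\<lambda>x. act x v)"
    and act_linear_right: "Vector_Spaces.linear mscale mscale (act x)"
    and act_bracket: "act (bracket x y) v = act x (act y v) - act y (act x v)"

definition submodule_of ::
  "(complex \<Rightarrow> 'v::ab_group_add \<Rightarrow> 'v) \<Rightarrow> ('g \<Rightarrow> 'v \<Rightarrow> 'v) \<Rightarrow> 'v set \<Rightarrow> 'v set \<Rightarrow> bool" where
  "submodule_of s act U V \<longleftrightarrow> U \<subseteq> V \<and> module.subspace s U \<and> (\<forall>x. \<forall>u\<in>U. act x u \<in> U)"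

definition irreducible_module ::
  "(complex \<Rightarrow> 'v::ab_group_add \<Rightarrow> 'v) \<Rightarrow> ('g \<Rightarrow> 'v \<Rightarrow> 'v) \<Rightarrow> bool" where
  "irreducible_module s act \<longleftrightarrow>
     (\<exists>v::'v. v \<noteq> 0) \<and> (\<forall>U. submodule_of s act U UNIV \<longrightarrow> U = {0} \<or> U = UNIV)"

text \<open>The module carried by the whole type \<open>'v\<close> is (a model of) \<open>V\<^sub>\<lambda>\<close>. No dominance is
  required of \<open>\<lambda>\<close>, and none of finite dimension of the module.\<close>

definition is_highest_weight_irrep ::
  "(complex \<Rightarrow> 'g::ab_group_add \<Rightarrow> 'g) \<Rightarrow> ('g \<Rightarrow> 'g \<Rightarrow> 'g) \<Rightarrow> (2 \<Rightarrow> 'g) \<Rightarrow> (2 \<Rightarrow> 'g) \<Rightarrow>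
   (complex \<Rightarrow> 'v::ab_group_add \<Rightarrow> 'v) \<Rightarrow> ('g \<Rightarrow> 'v \<Rightarrow> 'v) \<Rightarrow> weight \<Rightarrow> bool" where
  "is_highest_weight_irrep sg bracket e h s act lam \<longleftrightarrow>
     lie_module sg bracket s act \<and> irreducible_module s act \<and>
     (\<exists>v. v \<noteq> 0 \<and> (\<forall>i. act (e i) v = 0 \<and> act (h i) v = s (pairing lam i) v))"

text \<open>The tensor product of the vector spaces \<open>'v\<close> and \<open>'w\<close> is realised inside the dual of the space
  of bilinear forms on \<open>'v \<times> 'w\<close>, as the span of the evaluations \<open>\<beta> \<mapsto> \<beta> v w\<close>. Functionals are
  extended by 0 to arguments that are not bilinear. The universal property is proved below
  (\<open>tensor_universal\<close>).\<close>

type_synonym ('v, 'w) tensor = "('v \<Rightarrow> 'w \<Rightarrow> complex) \<Rightarrow> complex"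

definition bilinear_map ::
  "(complex \<Rightarrow> 'v::ab_group_add \<Rightarrow> 'v) \<Rightarrow> (complex \<Rightarrow> 'w::ab_group_add \<Rightarrow> 'w) \<Rightarrow>
   (complex \<Rightarrow> 'x::ab_group_add \<Rightarrow> 'x) \<Rightarrow> ('v \<Rightarrow> 'w \<Rightarrow> 'x) \<Rightarrow> bool" where
  "bilinear_map sv sw sx \<beta> \<longleftrightarrow>
     (\<forall>w. Vector_Spaces.linear sv sx (\<lambda>v. \<beta> v w)) \<and> (\<forall>v. Vector_Spaces.linear sw sx (\<beta> v))"

definition tscale :: "complex \<Rightarrow> ('v, 'w) tensor \<Rightarrow> ('v, 'w) tensor" where
  "tscale c T = (\<lambda>\<beta>. c * T \<beta>)"

definition pure_tensor ::
  "(complex \<Rightarrow> 'v::ab_group_add \<Rightarrow> 'v) \<Rightarrow> (complex \<Rightarrow> 'w::ab_group_add \<Rightarrow> 'w) \<Rightarrow>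
   'v \<Rightarrow> 'w \<Rightarrow> ('v, 'w) tensor" where
  "pure_tensor sv sw v w = (\<lambda>\<beta>. if bilinear_map sv sw (*) \<beta> then \<beta> v w else 0)"

definition tensor_space ::
  "(complex \<Rightarrow> 'v::ab_group_add \<Rightarrow> 'v) \<Rightarrow> (complex \<Rightarrow> 'w::ab_group_add \<Rightarrow> 'w) \<Rightarrow>
   ('v, 'w) tensor set" where
  "tensor_space sv sw = module.span tscale {pure_tensor sv sw v w | v w. True}"

text \<open>The action \<open>x (v \<otimes> w) = x v \<otimes> w + v \<otimes> x w\<close> (see \<open>tensor_act_pure\<close>), written as the transpose of
  an action on bilinear forms.\<close>

definition tensor_act ::
  "(complex \<Rightarrow> 'v::ab_group_add \<Rightarrow> 'v) \<Rightarrow> ('g \<Rightarrow> 'v \<Rightarrow> 'v) \<Rightarrow>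
   (complex \<Rightarrow> 'w::ab_group_add \<Rightarrow> 'w) \<Rightarrow> ('g \<Rightarrow> 'w \<Rightarrow> 'w) \<Rightarrow>
   'g \<Rightarrow> ('v, 'w) tensor \<Rightarrow> ('v, 'w) tensor" where
  "tensor_act sv av sw aw x T = (\<lambda>\<beta>.
     if bilinear_map sv sw (*) \<beta> then T (\<lambda>v w. \<beta> (av x v) w + \<beta> v (aw x w)) else 0)"

definition embeds_in_tensor ::
  "(complex \<Rightarrow> 'u::ab_group_add \<Rightarrow> 'u) \<Rightarrow> ('g \<Rightarrow> 'u \<Rightarrow> 'u) \<Rightarrow>
   (complex \<Rightarrow> 'v::ab_group_add \<Rightarrow> 'v) \<Rightarrow> ('g \<Rightarrow> 'v \<Rightarrow> 'v) \<Rightarrow>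
   (complex \<Rightarrow> 'w::ab_group_add \<Rightarrow> 'w) \<Rightarrow> ('g \<Rightarrow> 'w \<Rightarrow> 'w) \<Rightarrow> bool" where
  "embeds_in_tensor su au sv av sw aw \<longleftrightarrow>
     (\<exists>S \<phi>. submodule_of tscale (tensor_act sv av sw aw) S (tensor_space sv sw) \<and>
        Vector_Spaces.linear su tscale \<phi> \<and> bij_betw \<phi> UNIV S \<and>
        (\<forall>x u. \<phi> (au x u) = tensor_act sv av sw aw x (\<phi> u)))"

lemma vector_space_tscale: "vector_space tscale"
  by unfold_locales (auto simp: tscale_def fun_eq_iff algebra_simps)

lemma vector_space_times: "vector_space ((*) :: complex \<Rightarrow> complex \<Rightarrow> complex)"
  by unfold_locales (auto simp: algebra_simps)

lemma linear_iff_vector_space: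
  assumes "vector_space s1" "vector_space s2"
  shows "Vector_Spaces.linear s1 s2 f \<longleftrightarrow>
    (\<forall>x y. f (x + y) = f x + f y) \<and> (\<forall>c x. f (s1 c x) = s2 c (f x))"
  using assms
  by (auto simp: Vector_Spaces.linear_def module_hom_def module_hom_axioms_def module_iff_vector_space)

lemma bilinear_map_iff:
  assumes "vector_space sv" "vector_space sw" "vector_space sx"
  shows "bilinear_map sv sw sx \<beta> \<longleftrightarrow>
    (\<forall>v v' w. \<beta> (v + v') w = \<beta> v w + \<beta> v' w) \<and> (\<forall>c v w. \<beta> (sv c v) w = sx c (\<beta> v w)) \<and>
    (\<forall>v w w'. \<beta> v (w + w') = \<beta> v w + \<beta> v w') \<and> (\<forall>c v w. \<beta> v (sw c w) = sx c (\<beta> v w))"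
  using assms by (auto simp: bilinear_map_def linear_iff_vector_space)

lemma bilinear_pure_tensor:
  assumes "vector_space sv" "vector_space sw"
  shows "bilinear_map sv sw tscale (pure_tensor sv sw)"
  using assms
  by (auto simp: bilinear_map_iff vector_space_tscale vector_space_times pure_tensor_def
      tscale_def fun_eq_iff)

lemma tensor_act_pure:
  assumes "lie_module sg bracket sv av" "lie_module sg bracket sw aw"
  shows "tensor_act sv av sw aw x (pure_tensor sv sw v w) =
    pure_tensor sv sw (av x v) w + pure_tensor sv sw v (aw x w)"
proof -
  interpret V: lie_module sg bracket sv av by fact
  interpret W: lie_module sg bracket sw aw by fact
  have sv: "vector_space sv" and sw: "vector_space sw" by unfold_locales
  have "bilinear_map sv sw (*) (\<lambda>v w. \<beta> (av x v) w + \<beta> v (aw x w))"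
    if "bilinear_map sv sw (*) \<beta>" for \<beta>
    using that V.act_linear_right[of x] W.act_linear_right[of x]
    by (auto simp: bilinear_map_iff linear_iff_vector_space sv sw vector_space_times algebra_simps)
  then show ?thesis
    by (auto simp: tensor_act_def pure_tensor_def fun_eq_iff)
qed

lemma linear_tensor_act: "Vector_Spaces.linear tscale tscale (tensor_act sv av sw aw x)"
  by (auto simp: linear_iff_vector_space vector_space_tscale tensor_act_def tscale_def fun_eq_iff)

theorem tensor_universal:
  assumes sv: "vector_space sv" and sw: "vector_space sw" and sx: "vector_space sx"
    and \<beta>: "bilinear_map sv sw sx \<beta>"
  shows "\<exists>F. Vector_Spaces.linear tscale sx F \<and> (\<forall>v w. F (pure_tensor sv sw v w) = \<beta> v w)"
    and "\<And>F G. Vector_Spaces.linear tscale sx F \<Longrightarrow> Vector_Spaces.linear tscale sx G \<Longrightarrow>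
      (\<And>v w. F (pure_tensor sv sw v w) = \<beta> v w) \<Longrightarrow> (\<And>v w. G (pure_tensor sv sw v w) = \<beta> v w) \<Longrightarrow>
      T \<in> tensor_space sv sw \<Longrightarrow> F T = G T"
proof -
  interpret T: vector_space tscale by (rule vector_space_tscale)
  interpret X: vector_space sx by fact
  interpret TX: vector_space_pair tscale sx ..
  interpret C: vector_space "(*) :: complex \<Rightarrow> complex \<Rightarrow> complex" by (rule vector_space_times)
  interpret TC: vector_space_pair tscale "(*) :: complex \<Rightarrow> complex \<Rightarrow> complex" ..
  interpret XC: vector_space_pair sx "(*) :: complex \<Rightarrow> complex \<Rightarrow> complex" ..
  define P where "P = {pure_tensor sv sw v w | v w. True}"
  obtain B where B: "B \<subseteq> P" "T.independent B" "P \<subseteq> T.span B"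
    using T.maximal_independent_subset[of P] by blast
  from B(1) have "\<forall>b\<in>B. \<exists>v w. b = pure_tensor sv sw v w" by (auto simp: P_def)
  then obtain p q where pq: "\<And>b. b \<in> B \<Longrightarrow> b = pure_tensor sv sw (p b) (q b)" by metis
  obtain F where F: "Vector_Spaces.linear tscale sx F" "\<And>b. b \<in> B \<Longrightarrow> F b = \<beta> (p b) (q b)"
    using TX.linear_independent_extend[OF B(2), of "\<lambda>b. \<beta> (p b) (q b)"] by blast
  have "F (pure_tensor sv sw v w) = \<beta> v w" for v w
  proof (rule ccontr)
    assume neq: "F (pure_tensor sv sw v w) \<noteq> \<beta> v w"
    define d where "d = F (pure_tensor sv sw v w) - \<beta> v w"
    have "X.independent {d}" using neq by (simp add: d_def)
    then obtain \<phi> where \<phi>: "Vector_Spaces.linear sx (*) \<phi>" "\<phi> d = 1"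
      using XC.linear_independent_extend[of "{d}" "\<lambda>_. 1"] by auto
    have \<phi>\<beta>: "bilinear_map sv sw (*) (\<lambda>v w. \<phi> (\<beta> v w))"
      using \<beta> \<phi>(1) by (auto simp: bilinear_map_iff linear_iff_vector_space sv sw sx vector_space_times)
    have lin1: "Vector_Spaces.linear tscale (*) (\<lambda>T. \<phi> (F T))"
      using F(1) \<phi>(1) by (auto simp: linear_iff_vector_space sx vector_space_times vector_space_tscale)
    have lin2: "Vector_Spaces.linear tscale (*) (\<lambda>T. T (\<lambda>v w. \<phi> (\<beta> v w)))"
      by (auto simp: linear_iff_vector_space vector_space_times vector_space_tscale tscale_def)
    have eqB: "\<phi> (F b) = b (\<lambda>v w. \<phi> (\<beta> v w))" if "b \<in> B" for b
    proof -
      have "b (\<lambda>v w. \<phi> (\<beta> v w)) = pure_tensor sv sw (p b) (q b) (\<lambda>v w. \<phi> (\<beta> v w))"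
        using pq[OF that] by simp
      then show ?thesis using F(2)[OF that] \<phi>\<beta> by (simp add: pure_tensor_def)
    qed
    have "pure_tensor sv sw v w \<in> T.span B" using B(3) by (auto simp: P_def)
    from TC.linear_eq_on[OF lin1 lin2 this] eqB
    have "\<phi> (F (pure_tensor sv sw v w)) = \<phi> (\<beta> v w)"
      using \<phi>\<beta> by (simp add: pure_tensor_def)
    moreover have "\<phi> d = \<phi> (F (pure_tensor sv sw v w)) - \<phi> (\<beta> v w)"
      unfolding d_def using XC.linear_diff[OF \<phi>(1)] by blast
    ultimately show False using \<phi>(2) by simp
  qed
  with F(1) show "\<exists>F. Vector_Spaces.linear tscale sx F \<and> (\<forall>v w. F (pure_tensor sv sw v w) = \<beta> v w)"
    by blast
  fix F G assume FG: "Vector_Spaces.linear tscale sx F" "Vector_Spaces.linear tscale sx G"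
    and *: "\<And>v w. F (pure_tensor sv sw v w) = \<beta> v w" "\<And>v w. G (pure_tensor sv sw v w) = \<beta> v w"
    and T: "T \<in> tensor_space sv sw"
  from T have "T \<in> T.span P" by (simp add: tensor_space_def P_def)
  then show "F T = G T"
    by (rule TX.linear_eq_on[OF FG]) (auto simp: P_def *)
qed

text \<open>The unknowns are the lists \<open>t\<^sub>1\<close>, \<open>t\<^sub>2\<close> of lengths \<open>l\<^sub>1\<close>, \<open>l\<^sub>2\<close>. A term with
  \<open>(\<lambda>\<^sup>(\<^sup>s\<^sup>), \<alpha>\<^sub>j) = 0\<close> vanishes even when the variable equals \<open>z\<^sub>s\<close>, since \<open>0 / 0 = 0\<close>.\<close>

definition bethe_solution ::
  "weight list \<Rightarrow> complex list \<Rightarrow> nat \<times> nat \<Rightarrow> complex list \<Rightarrow> complex list \<Rightarrow> bool" where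
  "bethe_solution \<Lambda> z l t1 t2 \<longleftrightarrow>
     length t1 = fst l \<and> length t2 = snd l \<and>
     distinct (t1 @ t2) \<and>
     (\<forall>s<length \<Lambda>. weight_form (\<Lambda> ! s) (simple_root 1) \<noteq> 0 \<longrightarrow> z ! s \<notin> set t1) \<and>
     (\<forall>s<length \<Lambda>. weight_form (\<Lambda> ! s) (simple_root 2) \<noteq> 0 \<longrightarrow> z ! s \<notin> set t2) \<and>
     (\<forall>i<length t1.
        - (\<Sum>s<length \<Lambda>. weight_form (\<Lambda> ! s) (simple_root 1) / (t1 ! i - z ! s))
        - (\<Sum>k<length t2. 3 / (t1 ! i - t2 ! k))
        + (\<Sum>k\<in>{..<length t1} - {i}. 6 / (t1 ! i - t1 ! k)) = 0) \<and>
     (\<forall>i<length t2.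
        - (\<Sum>s<length \<Lambda>. weight_form (\<Lambda> ! s) (simple_root 2) / (t2 ! i - z ! s))
        - (\<Sum>k<length t1. 3 / (t2 ! i - t1 ! k))
        + (\<Sum>k\<in>{..<length t2} - {i}. 2 / (t2 ! i - t2 ! k)) = 0)"

definition represents_bethe_solution ::
  "weight list \<Rightarrow> complex list \<Rightarrow> nat \<times> nat \<Rightarrow> complex poly \<times> complex poly \<Rightarrow> bool" where
  "represents_bethe_solution \<Lambda> z l y \<longleftrightarrow>
     (\<exists>t1 t2. bethe_solution \<Lambda> z l t1 t2 \<and>
        fst y = (\<Prod>t\<leftarrow>t1. [:- t, 1:]) \<and> snd y = (\<Prod>t\<leftarrow>t2. [:- t, 1:]))"

definition l_vec :: "nat \<Rightarrow> nat \<times> nat" where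
  "l_vec i = [(0,0), (0,1), (1,1), (1,2), (1,3), (2,3), (2,4)] ! i"

definition y6_P3 :: "complex \<Rightarrow> complex \<Rightarrow> complex" where
  "y6_P3 a b = 9*a^4*(4*b+3) + 3*a^3*(30*b^2+78*b+47) + a^2*(80*b^3+372*b^2+562*b+270)
     + a*(30*b^4+208*b^3+528*b^2+578*b+228) + 2*(b+2)^2*(2*b^3+11*b^2+18*b+9)"

definition y6_P2 :: "complex \<Rightarrow> complex \<Rightarrow> complex" where
  "y6_P2 a b = 27*a^5*(1+2*b) + 3*a^4*(70+147*b+57*b^2) + 3*a^3*(215+493*b+333*b^2+70*b^3)
     + 2*(2+b)^2*(27+60*b+47*b^2+16*b^3+2*b^4)
     + a^2*(978+2498*b+2263*b^2+880*b^3+125*b^4)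
     + 2*a*(366+1049*b+1165*b^2+634*b^3+170*b^4+18*b^5)"

definition y6_P1 :: "complex \<Rightarrow> complex \<Rightarrow> complex" where
  "y6_P1 a b = 3*a^3*(1+4*b) + 2*(2+b)^2*(3+4*b+b^2) + 2*a^2*(9+28*b+11*b^2)
     + 2*a*(18+47*b+31*b^2+6*b^3)"

definition y6_c3 :: "complex \<Rightarrow> complex \<Rightarrow> complex" where
  "y6_c3 a b = 2 * y6_P3 a b / ((b+1)*(a+b+2)*(2*a+b+3)*(3*a+b+4)*(3*a+2*b+4))"

definition y6_c2 :: "complex \<Rightarrow> complex \<Rightarrow> complex" where
  "y6_c2 a b = 6*(1+a+b)*(2+2*a+b)*(3+3*a+2*b) * y6_P2 a b
     / ((b+1)*(a+b+2)^2*(2*a+b+3)^2*(3*a+b+4)*(3*a+2*b+4)^2*(3*a+2*b+5))"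

definition y6_c1 :: "complex \<Rightarrow> complex \<Rightarrow> complex" where
  "y6_c1 a b = 2*(1+a+b)^2*(2+2*a+b)^2*(3+3*a+2*b)^2 * y6_P1 a b
     / ((1+b)*(2+a+b)^3*(3+2*a+b)^3*(4+3*a+b)*(4+3*a+2*b)*(5+3*a+2*b))"

definition y6_c0 :: "complex \<Rightarrow> complex \<Rightarrow> complex" where
  "y6_c0 a b = b*(a+b+1)^3*(2*a+b+2)^3*(3*a+b+3)*(3*a+2*b+3)^2
     / ((b+1)*(a+b+2)^3*(2*a+b+3)^3*(3*a+b+4)*(3*a+2*b+5)^2)"

definition y1_poly :: "nat \<Rightarrow> complex \<Rightarrow> complex \<Rightarrow> complex poly" where
  "y1_poly i a b =
    [ 1,
      1,
      [: - (a*(3*a+b+3) / ((a+1)*(3*a+b+4))), 1 :],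
      [: - ((3*a+b+3)*(3*a+2*b+4) / ((3*a+b+5)*(3*a+2*b+6))), 1 :],
      [: - ((a+b+1)*(3*a+2*b+4) / ((a+b+2)*(3*a+2*b+5))), 1 :],
      [: a*(2*a+b+2)^2*(3*a+b+2)*(3*a+2*b+4) / ((a+1)*(2*a+b+3)^2*(3*a+b+4)*(3*a+2*b+5)),
         - (2*(2*a+b+2)*(3*a+b+2)*(3*a^2+2*a*b+6*a+b+3)
              / ((a+1)*(2*a+b+3)*(3*a+b+3)*(3*a+2*b+5))),
         1 :],
      [: (a+b+1)*(2*a+b+2)^2*(3*a+b+3)*(3*a+2*b+3) / ((a+b+2)*(2*a+b+3)^2*(3*a+b+4)*(3*a+2*b+5)),
         - (2*(2*a+b+2)*(3*a+2*b+3)*(3*a^2+4*a*b+b^2+8*a+5*b+6)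
              / ((a+b+2)*(2*a+b+3)*(3*a+b+4)*(3*a+2*b+4))),
         1 :]
    ] ! i"

definition y2_poly :: "nat \<Rightarrow> complex \<Rightarrow> complex \<Rightarrow> complex poly" where
  "y2_poly i a b =
    [ 1,
      [: - (b / (b+1)), 1 :],
      [: - ((3*a+b+3) / (3*a+b+4)), 1 :],
      [: b*(3*a+b+3)*(3*a+2*b+4)^2 / ((b+2)*(3*a+b+5)*(3*a+2*b+6)^2),
         - (2*(3*a+2*b+4)*(3*a+5*b+3*a*b+b^2+6) / ((b+2)*(3*a+b+5)*(3*a+2*b+6))),
         1 :],
      [: - ((b-1)*(a+b+1)^3*(3*a+2*b+4)^2 / ((b+1)*(a+b+2)^3*(3*a+2*b+5)^2)),
         3*(b-1)*(a+b+1)^2*(3*a+2*b+4)*(3*a*b+2*b^2+2*a+6*b+4)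
           / (b*(b+1)*(a+b+2)^2*(3*a+2*b+5)^2),
         - (3*(a+b+1)*(3*a*b+2*b^2-2*a+3*b-2) / (b*(a+b+2)*(3*a+2*b+5))),
         1 :],
      [: - ((2*a+b+2)^3*(3*a+b+2)*(3*a+2*b+4)^2 / ((2*a+b+3)^3*(3*a+b+4)*(3*a+2*b+5)^2)),
         3*(3*a+b+2)*(2*a+b+2)^2*(3*a+2*b+4)*(9*a^2+9*a*b+2*b^2+25*a+12*b+18)
           / ((2*a+b+3)^2*(3*a+b+3)*(3*a+b+4)*(3*a+2*b+5)^2),
         - (3*(2*a+b+2)*(9*a^2+9*a*b+2*b^2+20*a+9*b+11)
              / ((2*a+b+3)*(3*a+b+3)*(3*a+2*b+5))),
         1 :],
      [: y6_c0 a b, - y6_c1 a b, y6_c2 a b, - y6_c3 a b, 1 :]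
    ] ! i"

end

theory Submission
  imports Defs "HOL-Computational_Algebra.Fundamental_Theorem_Algebra"
begin

text \<open>The proof has an analytic half and a representation theoretic half, linked only by bounds on
  \<open>a\<close> and \<open>b\<close>.

  At a simple root \<open>t\<close> of \<open>y\<^sub>1\<close> the number \<open>y\<^sub>1''(t) / y\<^sub>1'(t)\<close> is twice the sum of \<open>1 / (t - t\<^sub>k)\<close> over
  the other roots, and \<open>y\<^sub>2'(t) / y\<^sub>2(t)\<close> is the sum of \<open>1 / (t - s)\<close> over the roots \<open>s\<close> of \<open>y\<^sub>2\<close>. Hence
  the Bethe ansatz equation says that certain differential polynomials \<open>bethe_ode1 a y\<^sub>1 y\<^sub>2\<close> and
  \<open>bethe_ode2 b y\<^sub>1 y\<^sub>2\<close> vanish at all roots of \<open>y\<^sub>1\<close>, respectively \<open>y\<^sub>2\<close>; equivalently, \<open>y\<^sub>1\<close> divides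
  the first and \<open>y\<^sub>2\<close> the second. These divisibilities turn \<open>y\<^sub>1\<close> and \<open>y\<^sub>2\<close> into solutions of linear
  second order equations with polynomial coefficients, and the exponents of these equations
  (\<open>indicial_equation\<close>) give most of the required distinctness for free: away from \<open>0\<close>, \<open>1\<close> and the
  roots of \<open>y\<^sub>1\<close> the exponents for \<open>y\<^sub>2\<close> are \<open>0\<close> and \<open>1\<close>, so its roots are simple there, and at a simple
  root of \<open>y\<^sub>1\<close> they are \<open>0\<close> and \<open>4\<close>, so a common root would force \<open>y\<^sub>2 = (x - t)\<^sup>4\<close>. What is left for
  each of the seven pairs (\<open>represents_bethe_solution_of_coeffs\<close>) is a finite list of polynomial
  identities in \<open>a\<close> and \<open>b\<close>, which exhibit the two quotients, and the nonvanishing of \<open>y\<^sub>1(0)\<close>, \<open>y\<^sub>2(0)\<close>,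
  \<open>y\<^sub>2(1)\<close>, the discriminant of \<open>y\<^sub>1\<close> and, in degree four, an obstruction to being a fourth power.
  For natural numbers \<open>a\<close>, \<open>b\<close> these are nonzero because, apart from possible factors \<open>a\<close>, \<open>b\<close> and
  \<open>b - 1\<close>, their numerators are up to sign polynomials with natural coefficients and positive
  constant term.

  Those factors are where admissibility enters: it must exclude \<open>b = 0\<close> for \<open>\<^bold>l\<^sub>1\<close>, \<open>\<^bold>l\<^sub>3\<close>, \<open>\<^bold>l\<^sub>6\<close>, \<open>a = 0\<close>
  for \<open>\<^bold>l\<^sub>2\<close>, \<open>\<^bold>l\<^sub>5\<close>, and \<open>b \<le> 1\<close> for \<open>\<^bold>l\<^sub>4\<close> (\<open>admissible_implies_bounds\<close>). An embedding of an irreducible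
  module into \<open>V \<otimes> W\<close>, where \<open>W = V\<^bsub>\<omega>\<^sub>2\<^esub>\<close>, yields a singular vector \<open>T\<close> there. Contracting \<open>T\<close> with the
  covector of \<open>V\<close> dual to the highest weight vector gives a nonzero vector \<open>x \<in> W\<close> of weight
  \<open>\<omega>\<^sub>2 - l\<^sub>1 \<alpha>\<^sub>1 - l\<^sub>2 \<alpha>\<^sub>2\<close>, and singularity of \<open>T\<close> translates into \<open>e\<^sub>i\<^sup>n\<^sup>+\<^sup>1 x = 0\<close> for \<open>n = \<langle>\<lambda>, \<alpha>\<^sub>i\<^sup>\<or>\<rangle>\<close>
  (\<open>singular_tensor\<close>; only \<open>n = 0\<close> and \<open>n = 1\<close> occur below). In the explicit basis of the
  seven-dimensional module \<open>W\<close> one reads off that this fails for the excluded values.\<close>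

section \<open>Differential equations behind the Bethe ansatz equation\<close>

text \<open>Frobenius: if \<open>y\<close> has a root of order \<open>n\<close> at \<open>t\<close>, the coefficient of \<open>(x - t)\<^sup>n\<close> in the equation is
  the indicial polynomial at \<open>n\<close> times the leading coefficient of \<open>y\<close> at \<open>t\<close>. Regular points are
  covered as well, after multiplication of the equation by \<open>(x - t)\<^sup>2\<close>.\<close>

lemma indicial_equation:
  fixes y \<alpha> \<beta> \<gamma> :: "'a::field_char_0 poly"
  assumes ode: "[:- t, 1:]^2 * \<alpha> * pderiv (pderiv y) + [:- t, 1:] * \<beta> * pderiv y + \<gamma> * y = 0"
    and "y \<noteq> 0"
  defines "n \<equiv> of_nat (order t y)"
  shows "n * (n - 1) * poly \<alpha> t + n * poly \<beta> t + poly \<gamma> t = 0"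
proof -
  define z where "z = [:- t, 1:]"
  define w where "w = z ^ order t y"
  obtain v where y: "y = w * v" and v: "\<not> z dvd v"
    using order_decomp[OF \<open>y \<noteq> 0\<close>, of t] by (auto simp: z_def w_def)
  have v0: "poly v t \<noteq> 0" using v by (simp add: z_def poly_eq_0_iff_dvd)
  have dz: "pderiv z = 1" by (simp add: z_def pderiv_pCons)
  have zp: "z * pderiv (z ^ k) = smult (of_nat k) (z ^ k)" for k
    by (cases k) (simp_all add: pderiv_power_Suc dz del: power_Suc, simp add: mult_ac)
  define D where "D = (\<lambda>p. smult n p + z * pderiv p)"
  have D: "z * pderiv (w * p) = w * D p" for p
  proof -
    have "z * pderiv (w * p) = w * (z * pderiv p) + (z * pderiv (w)) * p"
      unfolding pderiv_mult by algebra
    then show ?thesis by (simp add: zp[of "order t y", folded w_def] D_def n_def distrib_left)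
  qed
  have y1: "z * pderiv y = w * D v"
    using D[of v] y by simp
  \<comment> \<open>With \<open>\<theta> = z d/dz\<close> one has \<open>z\<^sup>2 y'' = \<theta> (\<theta> y) - \<theta> y\<close>, and \<open>\<theta>\<close> acts on \<open>w * p\<close> as \<open>D\<close> on \<open>p\<close>.\<close>
  have "z * pderiv (z * pderiv y) = z * pderiv y + z^2 * pderiv (pderiv y)"
    by (simp add: pderiv_mult dz power2_eq_square algebra_simps)
  then have y2: "z^2 * pderiv (pderiv y) = w * (D (D v) - D v)"
    using D[of "D v"] y1 by (simp add: algebra_simps)
  have "w * (\<alpha> * (D (D v) - D v) + \<beta> * D v + \<gamma> * v)
      = \<alpha> * (z^2 * pderiv (pderiv y)) + \<beta> * (z * pderiv y) + \<gamma> * y"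
    unfolding y1 y2 by (subst y) algebra
  also have "\<dots> = 0" using ode by (simp add: z_def algebra_simps)
  finally have "\<alpha> * (D (D v) - D v) + \<beta> * D v + \<gamma> * v = 0"
    by (simp add: z_def w_def)
  then have "poly (\<alpha> * (D (D v) - D v) + \<beta> * D v + \<gamma> * v) t = 0" by simp
  then have "poly v t * (n * (n - 1) * poly \<alpha> t + n * poly \<beta> t + poly \<gamma> t) = 0"
    by (simp add: D_def z_def algebra_simps)
  with v0 show ?thesis by simp
qed

text \<open>Up to sign and a constant factor these are the two groups of Bethe equations for \<open>\<^bold>\<Lambda> = (\<lambda>, \<omega>\<^sub>2)\<close> and
  \<open>\<^bold>z = (0, 1)\<close> after multiplication by all denominators and by the derivative of the polynomial whose
  roots are inserted. The pairings are \<open>(\<lambda>, \<alpha>\<^sub>1) = 3 a\<close>, \<open>(\<lambda>, \<alpha>\<^sub>2) = b\<close>, \<open>(\<omega>\<^sub>2, \<alpha>\<^sub>1) = 0\<close>, \<open>(\<omega>\<^sub>2, \<alpha>\<^sub>2) = 1\<close>,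
  so \<open>1\<close> is a singular point of the second equation only.\<close>

definition bethe_ode1 :: "complex \<Rightarrow> complex poly \<Rightarrow> complex poly \<Rightarrow> complex poly" where
  "bethe_ode1 a y1 y2 =
     [:0, 1:] * y2 * pderiv (pderiv y1) - (smult a y2 + [:0, 1:] * pderiv y2) * pderiv y1"

definition bethe_ode2 :: "complex \<Rightarrow> complex poly \<Rightarrow> complex poly \<Rightarrow> complex poly" where
  "bethe_ode2 b y1 y2 =
     [:0, -1, 1:] * y1 * pderiv (pderiv y2) - ([:- b, b + 1:] * y1 + [:0, -3, 3:] * pderiv y1) * pderiv y2"

text \<open>The point \<open>t\<close> is a regular point of the equation, with exponents \<open>0\<close> and \<open>1\<close>.\<close>

lemma simple_roots_of_ode2:
  assumes dvd: "y2 dvd bethe_ode2 b y1 y2" and t: "poly y2 t = 0" and "y2 \<noteq> 0"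
    and "t \<noteq> 0" "t \<noteq> 1" "poly y1 t \<noteq> 0"
  shows "poly (pderiv y2) t \<noteq> 0"
proof -
  obtain q where q: "bethe_ode2 b y1 y2 = y2 * q" using dvd by (elim dvdE)
  let ?n = "of_nat (order t y2) :: complex"
  have "[:- t, 1:]^2 * ([:0, -1, 1:] * y1) * pderiv (pderiv y2)
      + [:- t, 1:] * (- [:- t, 1:] * ([:- b, b + 1:] * y1 + [:0, -3, 3:] * pderiv y1)) * pderiv y2
      + (- ([:- t, 1:]^2) * q) * y2 = [:- t, 1:]^2 * (bethe_ode2 b y1 y2 - y2 * q)"
    unfolding bethe_ode2_def by algebra
  also have "\<dots> = 0" using q by simp
  finally have "?n * (?n - 1) * poly ([:0, -1, 1:] * y1) t
      + ?n * poly (- [:- t, 1:] * ([:- b, b + 1:] * y1 + [:0, -3, 3:] * pderiv y1)) t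
      + poly (- ([:- t, 1:]^2) * q) t = 0"
    by (intro indicial_equation \<open>y2 \<noteq> 0\<close>)
  then have "?n * (?n - 1) * (poly y1 t * (t * (t - 1))) = 0" by (simp add: algebra_simps)
  then have "?n = 0 \<or> ?n = 1" using assms(4-6) by simp
  moreover have "order t y2 \<noteq> 0" using t \<open>y2 \<noteq> 0\<close> by (simp add: order_root)
  ultimately have "order t y2 = 1" by simp
  then obtain v where v: "y2 = [:- t, 1:] * v" "\<not> [:- t, 1:] dvd v"
    using order_decomp[OF \<open>y2 \<noteq> 0\<close>, of t] by auto
  then have "poly (pderiv y2) t = poly v t" by (simp add: pderiv_mult pderiv_pCons del: mult_pCons_left)
  with v(2) show ?thesis by (simp add: poly_eq_0_iff_dvd)
qed

text \<open>A simple root of \<open>y\<^sub>1\<close> makes \<open>t\<close> a regular singular point of the equation for \<open>y\<^sub>2\<close>: the indicial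
  polynomial is proportional to \<open>n (n - 1) - 3 n\<close>.\<close>

lemma common_root_order:
  assumes dvd: "y2 dvd bethe_ode2 b y1 y2" and "poly y1 t = 0" "poly (pderiv y1) t \<noteq> 0"
    and "y2 \<noteq> 0" "poly y2 t = 0" "t \<noteq> 0" "t \<noteq> 1"
  shows "order t y2 = 4"
proof -
  obtain q where q: "bethe_ode2 b y1 y2 = y2 * q" using dvd by (elim dvdE)
  obtain u where u: "y1 = [:- t, 1:] * u" using \<open>poly y1 t = 0\<close> by (auto simp: poly_eq_0_iff_dvd elim: dvdE)
  have du: "poly (pderiv y1) t = poly u t"
    unfolding u by (simp add: pderiv_mult pderiv_pCons del: mult_pCons_left)
  let ?n = "of_nat (order t y2) :: complex"
  let ?\<beta> = "- ([:- b, b + 1:] * y1 + [:0, -3, 3:] * pderiv y1)"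
  have "[:- t, 1:]^2 * ([:0, -1, 1:] * u) * pderiv (pderiv y2) + [:- t, 1:] * ?\<beta> * pderiv y2
      + (- ([:- t, 1:] * q)) * y2 = [:- t, 1:] * (bethe_ode2 b y1 y2 - y2 * q)"
    unfolding bethe_ode2_def u by algebra
  also have "\<dots> = 0" using q by simp
  finally have "?n * (?n - 1) * poly ([:0, -1, 1:] * u) t + ?n * poly ?\<beta> t
      + poly (- ([:- t, 1:] * q)) t = 0"
    by (intro indicial_equation \<open>y2 \<noteq> 0\<close>)
  then have "?n * (?n - 1) * poly ([:0, -1, 1:] * u) t + ?n * poly ?\<beta> t = 0" by simp
  moreover have "poly ?\<beta> t = - (3 * (t * (t - 1) * poly u t))"
    using \<open>poly y1 t = 0\<close> by (simp add: du algebra_simps)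
  moreover have "poly ([:0, -1, 1:] * u) t = t * (t - 1) * poly u t" by (simp add: algebra_simps)
  ultimately have "?n * (?n - 4) * (t * (t - 1) * poly u t) = 0" by algebra
  then have "?n * (?n - 4) = 0" using assms du by simp
  moreover have "order t y2 \<noteq> 0" using assms by (simp add: order_root)
  ultimately have "?n = of_nat 4" by simp
  then show ?thesis by (simp only: of_nat_eq_iff)
qed

lemma log_deriv_prod:
  fixes f :: "'i \<Rightarrow> complex"
  assumes "finite I" "\<And>k. k \<in> I \<Longrightarrow> t \<noteq> f k"
  shows "poly (pderiv (\<Prod>k\<in>I. [:- f k, 1:])) t = poly (\<Prod>k\<in>I. [:- f k, 1:]) t * (\<Sum>k\<in>I. 1 / (t - f k))"
  using assms
proof (induction I)
  case (insert i I)
  have "t - f i \<noteq> 0" using insert.prems by simp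
  have "poly (pderiv (\<Prod>k\<in>insert i I. [:- f k, 1:])) t
      = (t - f i) * poly (pderiv (\<Prod>k\<in>I. [:- f k, 1:])) t + poly (\<Prod>k\<in>I. [:- f k, 1:]) t"
    using insert.hyps by (simp add: pderiv_mult pderiv_pCons del: mult_pCons_left)
  also have "\<dots> = (t - f i) * poly (\<Prod>k\<in>I. [:- f k, 1:]) t * (1 / (t - f i) + (\<Sum>k\<in>I. 1 / (t - f k)))"
    using insert.IH insert.prems \<open>t - f i \<noteq> 0\<close> by (simp add: distrib_left)
  finally show ?case using insert.hyps by (simp add: poly_mult algebra_simps del: mult_pCons_left)
qed simp

lemma prod_list_linear_factors:
  "(\<Prod>s\<leftarrow>ts. [:- s, 1:]) = (\<Prod>k<length ts. [:- (ts ! k), 1::complex:])"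
  by (subst prod.list_conv_set_nth) (simp add: atLeast0LessThan)

lemma log_deriv_prod_list:
  fixes ts :: "complex list"
  assumes "t \<notin> set ts"
  shows "poly (pderiv (\<Prod>s\<leftarrow>ts. [:- s, 1:])) t
    = poly (\<Prod>s\<leftarrow>ts. [:- s, 1:]) t * (\<Sum>k<length ts. 1 / (t - ts ! k))"
  using assms unfolding prod_list_linear_factors
  by (intro log_deriv_prod) (auto simp: in_set_conv_nth)

lemma second_deriv_at_root:
  fixes ts :: "complex list"
  assumes "distinct ts" "i < length ts"
  defines "y \<equiv> (\<Prod>s\<leftarrow>ts. [:- s, 1:])"
  shows "poly (pderiv (pderiv y)) (ts ! i)
      = 2 * poly (pderiv y) (ts ! i) * (\<Sum>k\<in>{..<length ts} - {i}. 1 / (ts ! i - ts ! k))"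
    and "poly (pderiv y) (ts ! i) \<noteq> 0" and "poly y (ts ! i) = 0"
proof -
  let ?I = "{..<length ts} - {i}"
  define u where "u = (\<Prod>k\<in>?I. [:- (ts ! k), 1:])"
  have y: "y = [:- (ts ! i), 1:] * u"
    unfolding y_def prod_list_linear_factors u_def using assms(2) by (subst prod.remove[of _ i]) auto
  have ne: "ts ! i \<noteq> ts ! k" if "k \<in> ?I" for k
    using that assms by (auto simp: nth_eq_iff_index_eq)
  have 1: "poly (pderiv y) (ts ! i) = poly u (ts ! i)"
    and 2: "poly (pderiv (pderiv y)) (ts ! i) = 2 * poly (pderiv u) (ts ! i)"
    unfolding y by (simp_all add: pderiv_mult pderiv_pCons pderiv_add del: mult_pCons_left)
  show "poly (pderiv (pderiv y)) (ts ! i)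
      = 2 * poly (pderiv y) (ts ! i) * (\<Sum>k\<in>?I. 1 / (ts ! i - ts ! k))"
    unfolding 1 2 unfolding u_def by (subst log_deriv_prod) (use ne in auto)
  show "poly (pderiv y) (ts ! i) \<noteq> 0"
    unfolding 1 u_def using ne by (auto simp: poly_prod)
  show "poly y (ts ! i) = 0" by (simp add: y)
qed

text \<open>Passage from a polynomial to the list of unknowns of the Bethe ansatz equation.\<close>

lemma split_into_distinct_linear_factors:
  fixes y :: "complex poly"
  assumes "lead_coeff y = 1" "\<And>t. poly y t = 0 \<Longrightarrow> poly (pderiv y) t \<noteq> 0"
  obtains ts where "distinct ts" "set ts = {t. poly y t = 0}" "y = (\<Prod>t\<leftarrow>ts. [:- t, 1:])"
    "length ts = degree y"
proof -
  have "y \<noteq> 0" using assms(1) by auto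
  then obtain ts where ts: "set ts = {t. poly y t = 0}" "distinct ts"
    using finite_distinct_list[OF poly_roots_finite] by blast
  have "rsquarefree y" using assms(2) by (auto simp: rsquarefree_roots)
  from complex_poly_decompose_rsquarefree[OF this] have y: "y = (\<Prod>t\<in>set ts. [:- t, 1:])"
    by (simp add: assms(1) ts(1))
  also have "\<dots> = (\<Prod>t\<leftarrow>ts. [:- t, 1:])" using ts(2) by (rule prod.distinct_set_conv_list)
  finally have "y = (\<Prod>t\<leftarrow>ts. [:- t, 1:])" .
  moreover have "degree (\<Prod>t\<in>set ts. [:- t, 1:]) = card (set ts)"
    by (subst degree_prod_sum_eq) auto
  then have "length ts = degree y" using y ts(2) by (simp add: distinct_card)
  ultimately show ?thesis using ts that by blast
qed

text \<open>The order \<open>4\<close> of \<open>y\<^sub>2\<close> at a hypothetical common root exhausts its degree, which is why fourth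
  powers are the only exception to coprimality that has to be excluded by hand.\<close>

lemma represents_bethe_solutionI:
  assumes a: "a = pairing lam 1" and b: "b = pairing lam 2"
    and monic: "lead_coeff y1 = 1" "lead_coeff y2 = 1" and deg: "degree y1 = l1" "degree y2 = l2"
    and ode1: "y1 dvd bethe_ode1 a y1 y2" and ode2: "y2 dvd bethe_ode2 b y1 y2"
    and y1_0: "poly y1 0 \<noteq> 0" and y2_0: "poly y2 0 \<noteq> 0" and y2_1: "poly y2 1 \<noteq> 0"
    and simple: "\<And>t. poly y1 t = 0 \<Longrightarrow> poly (pderiv y1) t \<noteq> 0"
    and no4: "\<And>t. y2 \<noteq> [:- t, 1:] ^ 4" and l2: "l2 \<le> 4"
  shows "represents_bethe_solution [lam, fund_weight 2] [0, 1] (l1, l2) (y1, y2)"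
proof -
  have "y2 \<noteq> 0" using monic by auto
  have coprime: "poly y2 t \<noteq> 0" if t: "poly y1 t = 0" for t
  proof
    assume "poly y2 t = 0"
    with t y2_0 y2_1 have "order t y2 = 4"
      by (intro common_root_order[OF ode2 t simple[OF t] \<open>y2 \<noteq> 0\<close>]) auto
    then have "[:- t, 1:] ^ 4 dvd y2" using order_1[of t y2] by simp
    then obtain v where v: "y2 = [:- t, 1:] ^ 4 * v" by (elim dvdE)
    have "v \<noteq> 0" using v \<open>y2 \<noteq> 0\<close> by auto
    then have "degree y2 = 4 + degree v" unfolding v by (subst degree_mult_eq) (auto simp: degree_linear_power)
    then have "degree v = 0" using deg l2 by simp
    moreover have "lead_coeff v = 1" using monic(2) unfolding v by (simp add: lead_coeff_mult lead_coeff_power)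
    ultimately have "v = 1" by (auto elim!: degree_eq_zeroE)
    with v no4 show False by auto
  qed
  obtain t1 where t1: "distinct t1" "set t1 = {t. poly y1 t = 0}" "y1 = (\<Prod>t\<leftarrow>t1. [:- t, 1:])"
    "length t1 = degree y1"
    using split_into_distinct_linear_factors[OF monic(1) simple] by metis
  have "poly (pderiv y2) t \<noteq> 0" if "poly y2 t = 0" for t
    using that y2_0 y2_1 coprime by (intro simple_roots_of_ode2[OF ode2 that \<open>y2 \<noteq> 0\<close>]) auto
  then obtain t2 where t2: "distinct t2" "set t2 = {t. poly y2 t = 0}" "y2 = (\<Prod>t\<leftarrow>t2. [:- t, 1:])"
    "length t2 = degree y2"
    using split_into_distinct_linear_factors[OF monic(2)] by metis
  have form:
    "weight_form lam (simple_root 1) = 3 * a" "weight_form lam (simple_root 2) = b"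
    "weight_form (fund_weight 2) (simple_root 1) = 0" "weight_form (fund_weight 2) (simple_root 2) = 1"
    using pairing_fund_weight[of 2 1] pairing_fund_weight[of 2 2]
    by (simp_all add: a b weight_form_expand simple_root_def axis_def pairing_1 pairing_2)
  have eq1: "- (3 * a / t1 ! i) - (\<Sum>k<length t2. 3 / (t1 ! i - t2 ! k))
        + (\<Sum>k\<in>{..<length t1} - {i}. 6 / (t1 ! i - t1 ! k)) = 0" if i: "i < length t1" for i
  proof -
    let ?t = "t1 ! i"
    have t: "poly y1 ?t = 0" using t1(2) i nth_mem by blast
    then have ne: "poly y2 ?t \<noteq> 0" "?t \<noteq> 0" using coprime y1_0 by auto
    define S2 S1 where "S2 = (\<Sum>k<length t2. 1 / (?t - t2 ! k))"
      and "S1 = (\<Sum>k\<in>{..<length t1} - {i}. 1 / (?t - t1 ! k))"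
    have d1: "poly (pderiv (pderiv y1)) ?t = 2 * poly (pderiv y1) ?t * S1" "poly (pderiv y1) ?t \<noteq> 0"
      using second_deriv_at_root[OF t1(1) i] by (simp_all add: t1(3)[symmetric] S1_def)
    have d2: "poly (pderiv y2) ?t = poly y2 ?t * S2"
      using log_deriv_prod_list[of ?t t2] ne t2 by (simp add: S2_def)
    have "poly (bethe_ode1 a y1 y2) ?t = 0" using ode1 t by (auto elim!: dvdE)
    then have "poly y2 ?t * poly (pderiv y1) ?t * (2 * ?t * S1 - a - ?t * S2) = 0"
      by (simp add: bethe_ode1_def d1(1) d2 algebra_simps)
    then have "2 * ?t * S1 - a - ?t * S2 = 0" using ne d1(2) by simp
    then have "- (3 * a / ?t) - 3 * S2 + 6 * S1 = 0" using ne(2) by (simp add: divide_simps) algebra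
    then show ?thesis by (simp add: S1_def S2_def sum_distrib_left)
  qed
  have eq2: "- (b / t2 ! i + 1 / (t2 ! i - 1)) - (\<Sum>k<length t1. 3 / (t2 ! i - t1 ! k))
        + (\<Sum>k\<in>{..<length t2} - {i}. 2 / (t2 ! i - t2 ! k)) = 0" if i: "i < length t2" for i
  proof -
    let ?t = "t2 ! i"
    have t: "poly y2 ?t = 0" using t2(2) i nth_mem by blast
    then have ne: "poly y1 ?t \<noteq> 0" "?t \<noteq> 0" "?t - 1 \<noteq> 0" using coprime y2_0 y2_1 by auto
    define S2 S1 where "S2 = (\<Sum>k\<in>{..<length t2} - {i}. 1 / (?t - t2 ! k))"
      and "S1 = (\<Sum>k<length t1. 1 / (?t - t1 ! k))"
    have d2: "poly (pderiv (pderiv y2)) ?t = 2 * poly (pderiv y2) ?t * S2" "poly (pderiv y2) ?t \<noteq> 0"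
      using second_deriv_at_root[OF t2(1) i] by (simp_all add: t2(3)[symmetric] S2_def)
    have d1: "poly (pderiv y1) ?t = poly y1 ?t * S1"
      using log_deriv_prod_list[of ?t t1] ne t1 by (simp add: S1_def)
    have "poly (bethe_ode2 b y1 y2) ?t = 0" using ode2 t by (auto elim!: dvdE)
    then have "poly y1 ?t * poly (pderiv y2) ?t
        * (2 * ?t * (?t - 1) * S2 - (b * (?t - 1) + ?t + 3 * ?t * (?t - 1) * S1)) = 0"
      by (simp add: bethe_ode2_def d2(1) d1 algebra_simps)
    then have "2 * ?t * (?t - 1) * S2 - (b * (?t - 1) + ?t + 3 * ?t * (?t - 1) * S1) = 0"
      using ne d2(2) by simp
    moreover have "?t * (?t - 1) * (- (b / ?t + 1 / (?t - 1)) - 3 * S1 + 2 * S2)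
        = 2 * ?t * (?t - 1) * S2 - (b * (?t - 1) + ?t + 3 * ?t * (?t - 1) * S1)"
      using ne(2,3) by (simp add: field_simps)
    ultimately have "- (b / ?t + 1 / (?t - 1)) - 3 * S1 + 2 * S2 = 0" using ne by simp
    then show ?thesis by (simp add: S1_def S2_def sum_distrib_left)
  qed
  have "distinct (t1 @ t2)" using t1 t2 coprime by auto
  moreover have "0 \<notin> set t1" "0 \<notin> set t2" "1 \<notin> set t2" using t1 t2 y1_0 y2_0 y2_1 by auto
  ultimately have "bethe_solution [lam, fund_weight 2] [0, 1] (l1, l2) t1 t2"
    using eq1 eq2 deg t1(4) t2(4)
    unfolding bethe_solution_def
    by (simp add: numeral_2_eq_2 lessThan_Suc All_less_Suc form add.commute)
  then show ?thesis
    unfolding represents_bethe_solution_def using t1(3) t2(3) by auto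
qed

section \<open>The criterion in terms of coefficients\<close>

lemma bethe_ode1_coeffs:
  "bethe_ode1 a [:p0, p1, p2:] [:r0, r1, r2, r3, r4:] =
    [: - a * p1 * r0,
       - (a + 1) * p1 * r1 - 2 * (a - 1) * p2 * r0,
       - (a + 2) * p1 * r2 - 2 * a * p2 * r1,
       - (a + 3) * p1 * r3 - 2 * (a + 1) * p2 * r2,
       - (a + 4) * p1 * r4 - 2 * (a + 2) * p2 * r3,
       - 2 * (a + 3) * p2 * r4 :]"
  by (simp add: bethe_ode1_def pderiv_pCons) algebra

lemma bethe_ode2_coeffs:
  "bethe_ode2 b [:p0, p1, p2:] [:r0, r1, r2, r3, r4:] =
    [: b * p0 * r1,
       - (b + 1) * p0 * r1 + 2 * (b - 1) * p0 * r2 + (b + 3) * p1 * r1,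
       - 2 * b * p0 * r2 + 3 * (b - 2) * p0 * r3 - (b + 4) * p1 * r1 + 2 * (b + 2) * p1 * r2
         + (b + 6) * p2 * r1,
       - 3 * (b - 1) * p0 * r3 + 4 * (b - 3) * p0 * r4 - 2 * (b + 3) * p1 * r2 + 3 * (b + 1) * p1 * r3
         - (b + 7) * p2 * r1 + 2 * (b + 5) * p2 * r2,
       - 4 * (b - 2) * p0 * r4 - 3 * (b + 2) * p1 * r3 + 4 * b * p1 * r4 - 2 * (b + 6) * p2 * r2
         + 3 * (b + 4) * p2 * r3,
       - 4 * (b + 1) * p1 * r4 - 3 * (b + 5) * p2 * r3 + 4 * (b + 3) * p2 * r4,
       - 4 * (b + 4) * p2 * r4 :]"
  by (simp add: bethe_ode2_def pderiv_pCons) (intro conjI; algebra)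

text \<open>Divisibility with an explicit quotient, compared coefficientwise. The polynomials are written as
  \<open>u\<^sup>2 P(v x / u)\<close> and \<open>u\<^sup>4 R(v x / u)\<close>: the roots of each pair have a common scale \<open>u / v\<close>, and
  pulling it out lets large powers of \<open>u\<close> and \<open>v\<close> cancel, which keeps the degrees in \<open>a\<close> and \<open>b\<close> of the
  remaining identities small. Polynomials of lower degree are padded with zeros.\<close>

lemma bethe_ode1_factor:
  fixes u v a p0 p1 p2 r0 r1 r2 r3 r4 :: complex
  assumes "- a * p1 * r0 = p0 * k0"
    and "- (a + 1) * p1 * r1 - 2 * (a - 1) * p2 * r0 = p0 * k1 + p1 * k0"
    and "- (a + 2) * p1 * r2 - 2 * a * p2 * r1 = p0 * k2 + p1 * k1 + p2 * k0"
    and "- (a + 3) * p1 * r3 - 2 * (a + 1) * p2 * r2 = p0 * k3 + p1 * k2 + p2 * k1"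
    and "- (a + 4) * p1 * r4 - 2 * (a + 2) * p2 * r3 = p1 * k3 + p2 * k2"
    and "- 2 * (a + 3) * p2 * r4 = p2 * k3"
  defines "Y1 \<equiv> [:u^2 * p0, u * v * p1, v^2 * p2:]"
    and "Y2 \<equiv> [:u^4 * r0, u^3 * v * r1, u^2 * v^2 * r2, u * v^3 * r3, v^4 * r4:]"
  shows "bethe_ode1 a Y1 Y2 = Y1 * [:u^3 * v * k0, u^2 * v^2 * k1, u * v^3 * k2, v^4 * k3:]"
proof -
  have "bethe_ode1 a Y1 Y2 =
    [:u^5 * v * (- a * p1 * r0),
      u^4 * v^2 * (- (a + 1) * p1 * r1 - 2 * (a - 1) * p2 * r0),
      u^3 * v^3 * (- (a + 2) * p1 * r2 - 2 * a * p2 * r1),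
      u^2 * v^4 * (- (a + 3) * p1 * r3 - 2 * (a + 1) * p2 * r2),
      u * v^5 * (- (a + 4) * p1 * r4 - 2 * (a + 2) * p2 * r3),
      v^6 * (- 2 * (a + 3) * p2 * r4):]"
    unfolding Y1_def Y2_def bethe_ode1_coeffs pCons_eq_iff by (intro conjI refl; algebra)
  also have "\<dots> = Y1 * [:u^3 * v * k0, u^2 * v^2 * k1, u * v^3 * k2, v^4 * k3:]"
    unfolding assms(1-6) unfolding Y1_def
    by (simp add: algebra_simps power2_eq_square power3_eq_cube; algebra)
  finally show ?thesis .
qed

text \<open>The second equation is not homogeneous in \<open>x\<close> because of its factor \<open>x - 1\<close>, so here \<open>u\<close> and \<open>v\<close>
  survive linearly.\<close>

lemma bethe_ode2_factor:
  fixes u v b p0 p1 p2 r0 r1 r2 r3 r4 :: complex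
  assumes "v * (b * p0 * r1) = r0 * m0"
    and "u * (- (b + 1) * p0 * r1) + v * (2 * (b - 1) * p0 * r2 + (b + 3) * p1 * r1) = r0 * m1 + r1 * m0"
    and "u * (- 2 * b * p0 * r2 - (b + 4) * p1 * r1)
        + v * (3 * (b - 2) * p0 * r3 + 2 * (b + 2) * p1 * r2 + (b + 6) * p2 * r1)
      = u * r0 * m2 + r1 * m1 + r2 * m0"
    and "u * (- 3 * (b - 1) * p0 * r3 - 2 * (b + 3) * p1 * r2 - (b + 7) * p2 * r1)
        + v * (4 * (b - 3) * p0 * r4 + 3 * (b + 1) * p1 * r3 + 2 * (b + 5) * p2 * r2)
      = u * r1 * m2 + r2 * m1 + r3 * m0"
    and "u * (- 4 * (b - 2) * p0 * r4 - 3 * (b + 2) * p1 * r3 - 2 * (b + 6) * p2 * r2)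
        + v * (4 * b * p1 * r4 + 3 * (b + 4) * p2 * r3)
      = u * r2 * m2 + r3 * m1 + r4 * m0"
    and "u * (- 4 * (b + 1) * p1 * r4 - 3 * (b + 5) * p2 * r3) + v * (4 * (b + 3) * p2 * r4)
      = u * r3 * m2 + r4 * m1"
    and "- 4 * (b + 4) * p2 * r4 = r4 * m2"
  defines "Y1 \<equiv> [:u^2 * p0, u * v * p1, v^2 * p2:]"
    and "Y2 \<equiv> [:u^4 * r0, u^3 * v * r1, u^2 * v^2 * r2, u * v^3 * r3, v^4 * r4:]"
  shows "bethe_ode2 b Y1 Y2 = Y2 * [:u * m0, v * m1, v^2 * m2:]"
proof -
  have "bethe_ode2 b Y1 Y2 =
    [:u^5 * (v * (b * p0 * r1)),
      u^4 * v * (u * (- (b + 1) * p0 * r1) + v * (2 * (b - 1) * p0 * r2 + (b + 3) * p1 * r1)),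
      u^3 * v^2 * (u * (- 2 * b * p0 * r2 - (b + 4) * p1 * r1)
        + v * (3 * (b - 2) * p0 * r3 + 2 * (b + 2) * p1 * r2 + (b + 6) * p2 * r1)),
      u^2 * v^3 * (u * (- 3 * (b - 1) * p0 * r3 - 2 * (b + 3) * p1 * r2 - (b + 7) * p2 * r1)
        + v * (4 * (b - 3) * p0 * r4 + 3 * (b + 1) * p1 * r3 + 2 * (b + 5) * p2 * r2)),
      u * v^4 * (u * (- 4 * (b - 2) * p0 * r4 - 3 * (b + 2) * p1 * r3 - 2 * (b + 6) * p2 * r2)
        + v * (4 * b * p1 * r4 + 3 * (b + 4) * p2 * r3)),
      v^5 * (u * (- 4 * (b + 1) * p1 * r4 - 3 * (b + 5) * p2 * r3) + v * (4 * (b + 3) * p2 * r4)),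
      v^6 * (- 4 * (b + 4) * p2 * r4):]"
    unfolding Y1_def Y2_def bethe_ode2_coeffs pCons_eq_iff by (intro conjI refl; algebra)
  also have "\<dots> = Y2 * [:u * m0, v * m1, v^2 * m2:]"
    unfolding assms(1-7) unfolding Y2_def
    by (simp add: algebra_simps power2_eq_square power3_eq_cube; algebra)
  finally show ?thesis .
qed

text \<open>At a root, the square of the derivative is the discriminant. For \<open>p\<^sub>2 = 0\<close> this is the linear case.\<close>

lemma simple_roots_of_discriminant:
  fixes p0 p1 p2 :: complex
  assumes "p1^2 \<noteq> 4 * p0 * p2" "poly [:p0, p1, p2:] t = 0"
  shows "poly (pderiv [:p0, p1, p2:]) t \<noteq> 0"
proof -
  have "poly (pderiv [:p0, p1, p2:]) t ^ 2 = p1^2 - 4 * p0 * p2 + 4 * p2 * poly [:p0, p1, p2:] t"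
    by (simp add: pderiv_pCons) algebra
  with assms show ?thesis by auto
qed

lemma fourth_power_coeffs:
  fixes t :: complex
  assumes "smult d ([:- t, 1:] ^ 4) = [:r0, r1, r2, r3, r4:]"
  shows "r1 * r3 = 16 * r0 * r4"
proof -
  have "r0 = d * t^4" "r1 = - (4 * d * t^3)" "r3 = - (4 * d * t)" "r4 = d"
    using assms by (auto simp: eval_nat_numeral algebra_simps)
  then show ?thesis by algebra
qed

lemma bethe_ode_smult:
  "bethe_ode1 a (smult c y1) (smult d y2) = smult (c * d) (bethe_ode1 a y1 y2)"
  "bethe_ode2 b (smult c y1) (smult d y2) = smult (c * d) (bethe_ode2 b y1 y2)"
  unfolding poly_eq_poly_eq_iff[symmetric] fun_eq_iff
  by (simp_all add: bethe_ode1_def bethe_ode2_def pderiv_smult algebra_simps)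

text \<open>The discriminant of \<open>y\<^sub>1\<close> and the relation between the coefficients of a fourth power are homogeneous,
  so the scale \<open>u / v\<close> drops out of them; it remains in the value of \<open>y\<^sub>2\<close> at \<open>1\<close>.\<close>

lemma represents_bethe_solution_of_coeffs:
  fixes u v p0 p1 p2 r0 r1 r2 r3 r4 :: complex
  defines "Y1 \<equiv> [:u^2 * p0, u * v * p1, v^2 * p2:]"
    and "Y2 \<equiv> [:u^4 * r0, u^3 * v * r1, u^2 * v^2 * r2, u * v^3 * r3, v^4 * r4:]"
  assumes ab: "a = pairing lam 1" "b = pairing lam 2"
    and monic: "lead_coeff y1 = 1" "lead_coeff y2 = 1" and deg: "degree y1 = l1" "degree y2 = l2" "l2 \<le> 4"
    and nz: "d1 \<noteq> 0" "d2 \<noteq> 0" "u \<noteq> 0" "v \<noteq> 0"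
    and y1: "smult d1 y1 = Y1" and y2: "smult d2 y2 = Y2"
    and ode1: "bethe_ode1 a Y1 Y2 = Y1 * q1" and ode2: "bethe_ode2 b Y1 Y2 = Y2 * q2"
    and at_0: "p0 \<noteq> 0" "r0 \<noteq> 0"
    and at_1: "u^4 * r0 + u^3 * v * r1 + u^2 * v^2 * r2 + u * v^3 * r3 + v^4 * r4 \<noteq> 0"
    and disc: "l1 = 0 \<or> p1^2 - 4 * p0 * p2 \<noteq> 0" and no4: "l2 < 4 \<or> r1 * r3 - 16 * r0 * r4 \<noteq> 0"
  shows "represents_bethe_solution [lam, fund_weight 2] [0, 1] (l1, l2) (y1, y2)"
proof (rule represents_bethe_solutionI[OF ab monic deg(1,2)])
  have "smult (d1 * d2) (bethe_ode1 a y1 y2) = y1 * smult d1 q1"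
    using ode1 unfolding y1[symmetric] y2[symmetric] bethe_ode_smult by simp
  then show "y1 dvd bethe_ode1 a y1 y2"
    using nz by (metis dvd_smult_cancel dvd_triv_left mult_eq_0_iff)
  have "smult (d1 * d2) (bethe_ode2 b y1 y2) = y2 * smult d2 q2"
    using ode2 unfolding y1[symmetric] y2[symmetric] bethe_ode_smult by simp
  then show "y2 dvd bethe_ode2 b y1 y2"
    using nz by (metis dvd_smult_cancel dvd_triv_left mult_eq_0_iff)
  have ev: "d1 * poly y1 t = poly Y1 t" "d2 * poly y2 t = poly Y2 t" for t
    using y1 y2 by (metis poly_smult)+
  show "poly y1 0 \<noteq> 0" "poly y2 0 \<noteq> 0"
    using ev[of 0] at_0 nz by (auto simp: Y1_def Y2_def)
  show "poly y2 1 \<noteq> 0"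
    using ev(2)[of 1] at_1 by (auto simp: Y2_def add.assoc)
  show "poly (pderiv y1) t \<noteq> 0" if "poly y1 t = 0" for t
  proof (cases "l1 = 0")
    case True
    then show ?thesis using that monic deg by (auto elim!: degree_eq_zeroE)
  next
    case False
    have "(u * v * p1)^2 - 4 * (u^2 * p0) * (v^2 * p2) = u^2 * v^2 * (p1^2 - 4 * p0 * p2)"
      by algebra
    then have "(u * v * p1)^2 - 4 * (u^2 * p0) * (v^2 * p2) \<noteq> 0" using disc False nz by simp
    then have "poly (pderiv Y1) t \<noteq> 0"
      using ev(1)[of t] that unfolding Y1_def by (intro simple_roots_of_discriminant) auto
    then show ?thesis unfolding y1[symmetric] by (simp add: pderiv_smult)
  qed
  show "y2 \<noteq> [:- t, 1:] ^ 4" for t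
  proof
    assume y2_eq: "y2 = [:- t, 1:] ^ 4"
    then have "l2 = 4" using deg(2) by (simp add: degree_linear_power)
    moreover have "(u^3 * v * r1) * (u * v^3 * r3) = 16 * (u^4 * r0) * (v^4 * r4)"
      using y2 unfolding y2_eq Y2_def by (rule fourth_power_coeffs)
    then have "u^4 * v^4 * (r1 * r3 - 16 * r0 * r4) = 0" by algebra
    ultimately show False using no4 nz by simp
  qed
qed (use deg in auto)

text \<open>Positivity in disguise: with the closure rules for \<open>\<nat>\<close> this shows that a polynomial with natural
  coefficients and nonzero constant term, written last, does not vanish at natural arguments.\<close>

lemma Nats_plus_nonzero:
  fixes x :: "'a::semiring_char_0"
  assumes "x \<in> \<nat>"
  shows "x + 1 \<noteq> 0" and "x + numeral k \<noteq> 0"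
proof -
  obtain j where "x = of_nat j" using assms by (elim Nats_cases)
  then have "x + 1 = of_nat (j + 1)" "x + numeral k = of_nat (j + numeral k)" by (simp_all add: add.commute)
  then show "x + 1 \<noteq> 0" "x + numeral k \<noteq> 0" by (simp_all only: of_nat_eq_0_iff) simp_all
qed

lemma Nats_power: "x \<in> \<nat> \<Longrightarrow> x ^ k \<in> \<nat>" for x :: "'a::semiring_1"
  by (induction k) auto

lemmas fraction_eq_simps = nonzero_divide_eq_eq nonzero_neg_divide_eq_eq

lemmas Nats_nonzero_intros = Nats_plus_nonzero Nats_add Nats_mult Nats_power Nats_numeral

section \<open>The six nontrivial pairs\<close>

text \<open>In each of the following lemmas \<open>p\<^sub>k\<close> and \<open>r\<^sub>k\<close> are the rescaled coefficients of multiples of \<open>y\<^sub>1\<close> and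
  \<open>y\<^sub>2\<close> with denominators cleared, and \<open>k\<^sub>j\<close> and \<open>m\<^sub>j\<close> are the coefficients of the two quotients; they are
  found by polynomial division over the rational functions in \<open>a\<close> and \<open>b\<close>. The scale \<open>u / v\<close> is the
  ratio of linear factors whose powers run through all coefficients of the pair. The polynomials
  \<open>S\<close>, \<open>\<Delta>\<close> and \<open>F\<close> are what remains of \<open>y\<^sub>2(1)\<close>, of the discriminant of \<open>y\<^sub>1\<close> and of the obstruction to
  \<open>y\<^sub>2\<close> being a fourth power, after removal of linear factors: all their coefficients are positive.
  The hypotheses \<open>nonzero\<close> keep the roots away from \<open>0\<close> or, for the fourth pair, also a denominator
  away from \<open>0\<close>. Some of the equations to be checked are trivial because of zero padding; the
  others are identities in the polynomial ring in \<open>a\<close> and \<open>b\<close>.\<close>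

lemma represents_bethe_solution_1:
  fixes a b :: complex
  assumes ab: "a = pairing lam 1" "b = pairing lam 2"
    and nat: "a \<in> \<nat>" "b \<in> \<nat>" and nonzero: "b \<noteq> 0"
  shows "represents_bethe_solution [lam, fund_weight 2] [0, 1] (0, 1)
    (y1_poly 1 a b, y2_poly 1 a b)"
proof -
  define u where "u = b"
  define v where "v = b+1"
  define p0 where "p0 = (1 :: complex)"
  define r0 where "r0 = (- 1 :: complex)"
  define r1 where "r1 = (1 :: complex)"
  define m0 where "m0 = - (b*(b+1))"
  note defs = u_def v_def p0_def r0_def r1_def m0_def
  have nz: "b+1 \<noteq> 0"
    by (intro Nats_nonzero_intros nat)+
  have at_1: "u^4 * r0 + u^3 * v * r1 + u^2 * v^2 * 0 + u * v^3 * 0 + v^4 * 0 = b^3"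
    unfolding defs by algebra
  show ?thesis
  proof (rule represents_bethe_solution_of_coeffs[OF ab])
    show "lead_coeff (y1_poly 1 a b) = 1" "lead_coeff (y2_poly 1 a b) = 1"
      "degree (y1_poly 1 a b) = 0" "degree (y2_poly 1 a b) = 1" "1 \<le> (4::nat)"
      by (simp_all add: y1_poly_def y2_poly_def)
    show "u^2 * p0 \<noteq> 0" "u^3 * v * r1 \<noteq> 0" "u \<noteq> 0" "v \<noteq> 0" "p0 \<noteq> 0" "r0 \<noteq> 0"
      unfolding defs
        neg_equal_0_iff_equal mult_eq_0_iff power_eq_0_iff
      using nz nonzero by simp_all
    show "smult (u^2 * p0) (y1_poly 1 a b) = [:u^2 * p0, u * v * 0, v^2 * 0:]"
      by (simp add: y1_poly_def fraction_eq_simps nz; (intro conjI)?; unfold defs; algebra)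
    show "smult (u^3 * v * r1) (y2_poly 1 a b) =
        [:u^4 * r0, u^3 * v * r1, u^2 * v^2 * 0, u * v^3 * 0, v^4 * 0:]"
      by (simp add: y2_poly_def fraction_eq_simps nz nonzero; (intro conjI)?; unfold defs; algebra)
    show "bethe_ode1 a [:u^2 * p0, u * v * 0, v^2 * 0:]
        [:u^4 * r0, u^3 * v * r1, u^2 * v^2 * 0, u * v^3 * 0, v^4 * 0:] =
      [:u^2 * p0, u * v * 0, v^2 * 0:] * [:u^3 * v * 0, u^2 * v^2 * 0, u * v^3 * 0, v^4 * 0:]"
      by (rule bethe_ode1_factor; (simp; fail | unfold defs, algebra))
    show "bethe_ode2 b [:u^2 * p0, u * v * 0, v^2 * 0:]
        [:u^4 * r0, u^3 * v * r1, u^2 * v^2 * 0, u * v^3 * 0, v^4 * 0:] =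
      [:u^4 * r0, u^3 * v * r1, u^2 * v^2 * 0, u * v^3 * 0, v^4 * 0:] * [:u * m0, v * 0, v^2 * 0:]"
      by (rule bethe_ode2_factor; (simp; fail | unfold defs, algebra))
    show "u^4 * r0 + u^3 * v * r1 + u^2 * v^2 * 0 + u * v^3 * 0 + v^4 * 0 \<noteq> 0"
      unfolding at_1 mult_eq_0_iff power_eq_0_iff using nz nonzero by simp
    show "0 = (0::nat) \<or> 0^2 - 4 * p0 * 0 \<noteq> 0"
      by simp
    show "1 < (4::nat) \<or> r1 * 0 - 16 * r0 * 0 \<noteq> 0"
      by simp
  qed
qed

lemma represents_bethe_solution_2:
  fixes a b :: complex
  assumes ab: "a = pairing lam 1" "b = pairing lam 2"
    and nat: "a \<in> \<nat>" "b \<in> \<nat>" and nonzero: "a \<noteq> 0"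
  shows "represents_bethe_solution [lam, fund_weight 2] [0, 1] (1, 1)
    (y1_poly 2 a b, y2_poly 2 a b)"
proof -
  define u where "u = 3*a+b+3"
  define v where "v = 3*a+b+4"
  define p0 where "p0 = - (a)"
  define p1 where "p1 = a+1"
  define r0 where "r0 = (- 1 :: complex)"
  define r1 where "r1 = (1 :: complex)"
  define k0 where "k0 = - (a+1)"
  define m0 where "m0 = b*a*(3*a+b+4)"
  define m1 where "m1 = - ((b+4)*(a+1)*(3*a+b+3))"
  note defs = u_def v_def p0_def p1_def r0_def r1_def k0_def m0_def m1_def
  have nz: "a+1 \<noteq> 0" "3*a+b+3 \<noteq> 0" "3*a+b+4 \<noteq> 0"
    by (intro Nats_nonzero_intros nat)+
  have at_1: "u^4 * r0 + u^3 * v * r1 + u^2 * v^2 * 0 + u * v^3 * 0 + v^4 * 0 = (3*a+b+3)^3"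
    unfolding defs by algebra
  show ?thesis
  proof (rule represents_bethe_solution_of_coeffs[OF ab])
    show "lead_coeff (y1_poly 2 a b) = 1" "lead_coeff (y2_poly 2 a b) = 1"
      "degree (y1_poly 2 a b) = 1" "degree (y2_poly 2 a b) = 1" "1 \<le> (4::nat)"
      by (simp_all add: y1_poly_def y2_poly_def)
    show "u * v * p1 \<noteq> 0" "u^3 * v * r1 \<noteq> 0" "u \<noteq> 0" "v \<noteq> 0" "p0 \<noteq> 0" "r0 \<noteq> 0"
      unfolding defs
        neg_equal_0_iff_equal mult_eq_0_iff power_eq_0_iff
      using nz nonzero by simp_all
    show "smult (u * v * p1) (y1_poly 2 a b) = [:u^2 * p0, u * v * p1, v^2 * 0:]"
      by (simp add: y1_poly_def fraction_eq_simps nz; (intro conjI)?; unfold defs; algebra)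
    show "smult (u^3 * v * r1) (y2_poly 2 a b) =
        [:u^4 * r0, u^3 * v * r1, u^2 * v^2 * 0, u * v^3 * 0, v^4 * 0:]"
      by (simp add: y2_poly_def fraction_eq_simps nz nonzero; (intro conjI)?; unfold defs; algebra)
    show "bethe_ode1 a [:u^2 * p0, u * v * p1, v^2 * 0:]
        [:u^4 * r0, u^3 * v * r1, u^2 * v^2 * 0, u * v^3 * 0, v^4 * 0:] =
      [:u^2 * p0, u * v * p1, v^2 * 0:] * [:u^3 * v * k0, u^2 * v^2 * 0, u * v^3 * 0, v^4 * 0:]"
      by (rule bethe_ode1_factor; (simp; fail | unfold defs, algebra))
    show "bethe_ode2 b [:u^2 * p0, u * v * p1, v^2 * 0:]
        [:u^4 * r0, u^3 * v * r1, u^2 * v^2 * 0, u * v^3 * 0, v^4 * 0:] =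
      [:u^4 * r0, u^3 * v * r1, u^2 * v^2 * 0, u * v^3 * 0, v^4 * 0:] * [:u * m0, v * m1, v^2 * 0:]"
      by (rule bethe_ode2_factor; (simp; fail | unfold defs, algebra))
    show "u^4 * r0 + u^3 * v * r1 + u^2 * v^2 * 0 + u * v^3 * 0 + v^4 * 0 \<noteq> 0"
      unfolding at_1 mult_eq_0_iff power_eq_0_iff using nz nonzero by simp
    show "1 = (0::nat) \<or> p1^2 - 4 * p0 * 0 \<noteq> 0"
      by (simp add: defs nz)
    show "1 < (4::nat) \<or> r1 * 0 - 16 * r0 * 0 \<noteq> 0"
      by simp
  qed
qed

lemma represents_bethe_solution_3:
  fixes a b :: complex
  assumes ab: "a = pairing lam 1" "b = pairing lam 2"
    and nat: "a \<in> \<nat>" "b \<in> \<nat>" and nonzero: "b \<noteq> 0"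
  shows "represents_bethe_solution [lam, fund_weight 2] [0, 1] (1, 2)
    (y1_poly 3 a b, y2_poly 3 a b)"
proof -
  define u where "u = 3*a+2*b+4"
  define v where "v = 3*a+2*b+6"
  define p0 where "p0 = - (3*a+b+3)"
  define p1 where "p1 = 3*a+b+5"
  define r0 where "r0 = b*(3*a+b+3)"
  define r1 where "r1 = - (2*(3*a*b + 3*a + b^2 + 5*b + 6))"
  define r2 where "r2 = (b+2)*(3*a+b+5)"
  define k0 where "k0 = b*a*(3*a+b+5)"
  define k1 where "k1 = - ((b+2)*(a+2)*(3*a+b+5))"
  define m0 where "m0 = 2*(3*a+2*b+6)*(3*a*b + 3*a + b^2 + 5*b + 6)"
  define m1 where "m1 = - (2*(b+3)*(3*a+b+5)*(3*a+2*b+4))"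
  note defs = u_def v_def p0_def p1_def r0_def r1_def r2_def k0_def k1_def m0_def m1_def
  have nz: "b+2 \<noteq> 0" "3*a+b+3 \<noteq> 0" "3*a+b+5 \<noteq> 0" "3*a+2*b+4 \<noteq> 0"
    "3*a+2*b+6 \<noteq> 0"
    by (intro Nats_nonzero_intros nat)+
  define S where "S = 3*a^2 + 6*a*b + 12*a + 2*b^2 + 10*b + 12"
  have S_nz: "S \<noteq> 0"
    unfolding S_def by (intro Nats_nonzero_intros nat)
  have at_1: "u^4 * r0 + u^3 * v * r1 + u^2 * v^2 * r2 + u * v^3 * 0 + v^4 * 0 = 6*(3*a+2*b+4)^2*S"
    unfolding defs S_def by algebra
  show ?thesis
  proof (rule represents_bethe_solution_of_coeffs[OF ab])
    show "lead_coeff (y1_poly 3 a b) = 1" "lead_coeff (y2_poly 3 a b) = 1"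
      "degree (y1_poly 3 a b) = 1" "degree (y2_poly 3 a b) = 2" "2 \<le> (4::nat)"
      by (simp_all add: y1_poly_def y2_poly_def)
    show "u * v * p1 \<noteq> 0" "u^2 * v^2 * r2 \<noteq> 0" "u \<noteq> 0" "v \<noteq> 0" "p0 \<noteq> 0" "r0 \<noteq> 0"
      unfolding defs
        neg_equal_0_iff_equal mult_eq_0_iff power_eq_0_iff
      using nz nonzero by simp_all
    show "smult (u * v * p1) (y1_poly 3 a b) = [:u^2 * p0, u * v * p1, v^2 * 0:]"
      by (simp add: y1_poly_def fraction_eq_simps nz; (intro conjI)?; unfold defs; algebra)
    show "smult (u^2 * v^2 * r2) (y2_poly 3 a b) =
        [:u^4 * r0, u^3 * v * r1, u^2 * v^2 * r2, u * v^3 * 0, v^4 * 0:]"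
      by (simp add: y2_poly_def fraction_eq_simps nz nonzero; (intro conjI)?; unfold defs; algebra)
    show "bethe_ode1 a [:u^2 * p0, u * v * p1, v^2 * 0:]
        [:u^4 * r0, u^3 * v * r1, u^2 * v^2 * r2, u * v^3 * 0, v^4 * 0:] =
      [:u^2 * p0, u * v * p1, v^2 * 0:] * [:u^3 * v * k0, u^2 * v^2 * k1, u * v^3 * 0, v^4 * 0:]"
      by (rule bethe_ode1_factor; (simp; fail | unfold defs, algebra))
    show "bethe_ode2 b [:u^2 * p0, u * v * p1, v^2 * 0:]
        [:u^4 * r0, u^3 * v * r1, u^2 * v^2 * r2, u * v^3 * 0, v^4 * 0:] =
      [:u^4 * r0, u^3 * v * r1, u^2 * v^2 * r2, u * v^3 * 0, v^4 * 0:] *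
      [:u * m0, v * m1, v^2 * 0:]"
      by (rule bethe_ode2_factor; (simp; fail | unfold defs, algebra))
    show "u^4 * r0 + u^3 * v * r1 + u^2 * v^2 * r2 + u * v^3 * 0 + v^4 * 0 \<noteq> 0"
      unfolding at_1 mult_eq_0_iff power_eq_0_iff using nz nonzero S_nz by simp
    show "1 = (0::nat) \<or> p1^2 - 4 * p0 * 0 \<noteq> 0"
      by (simp add: defs nz)
    show "2 < (4::nat) \<or> r1 * 0 - 16 * r0 * 0 \<noteq> 0"
      by simp
  qed
qed

lemma represents_bethe_solution_4:
  fixes a b :: complex
  assumes ab: "a = pairing lam 1" "b = pairing lam 2"
    and nat: "a \<in> \<nat>" "b \<in> \<nat>" and nonzero: "b \<noteq> 0" "b \<noteq> 1"
  shows "represents_bethe_solution [lam, fund_weight 2] [0, 1] (1, 3)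
    (y1_poly 4 a b, y2_poly 4 a b)"
proof -
  define u where "u = a+b+1"
  define v where "v = a+b+2"
  define p0 where "p0 = - (3*a+2*b+4)"
  define p1 where "p1 = 3*a+2*b+5"
  define r0 where "r0 = - ((b-1)*b*(3*a+2*b+4)^2)"
  define r1 where "r1 = 3*(b-1)*(3*a+2*b+4)*(3*a*b + 2*a + 2*b^2 + 6*b + 4)"
  define r2 where "r2 = - (3*(b+1)*(3*a+2*b+5)*(3*a*b - 2*a + 2*b^2 + 3*b - 2))"
  define r3 where "r3 = b*(b+1)*(3*a+2*b+5)^2"
  define k0 where "k0 = - ((b-1)*b*a*(3*a+2*b+4)*(3*a+2*b+5))"
  define k1 where "k1 = 2*(b-1)*(b+1)*(3*a+2*b+5)*(3*a^2 + 2*a*b + 9*a + 3*b + 6)"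
  define k2 where "k2 = - (b*(b+1)*(a+3)*(3*a+2*b+5)^2)"
  define m0 where "m0 = 3*(a+b+2)*(3*a*b + 2*a + 2*b^2 + 6*b + 4)"
  define m1 where "m1 = - (3*(b+2)*(a+b+1)*(3*a+2*b+5))"
  note defs = u_def v_def p0_def p1_def r0_def r1_def r2_def r3_def k0_def k1_def k2_def m0_def
    m1_def
  have nz: "b+1 \<noteq> 0" "a+b+1 \<noteq> 0" "a+b+2 \<noteq> 0" "3*a+2*b+4 \<noteq> 0"
    "3*a+2*b+5 \<noteq> 0"
    by (intro Nats_nonzero_intros nat)+
  define S where "S = 6*a^4 + 32*a^3*b + 36*a^3 + 66*a^2*b^2 + 144*a^2*b + 78*a^2 + 54*a*b^3
      + 198*a*b^2 + 216*a*b + 72*a + 15*b^4 + 81*b^3 + 150*b^2 + 108*b + 24"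
  have S_nz: "S \<noteq> 0"
    unfolding S_def by (intro Nats_nonzero_intros nat)
  have at_1: "u^4 * r0 + u^3 * v * r1 + u^2 * v^2 * r2 + u * v^3 * r3 + v^4 * 0 = (a+b+1)*S"
    unfolding defs S_def by algebra
  show ?thesis
  proof (rule represents_bethe_solution_of_coeffs[OF ab])
    show "lead_coeff (y1_poly 4 a b) = 1" "lead_coeff (y2_poly 4 a b) = 1"
      "degree (y1_poly 4 a b) = 1" "degree (y2_poly 4 a b) = 3" "3 \<le> (4::nat)"
      by (simp_all add: y1_poly_def y2_poly_def)
    show "u * v * p1 \<noteq> 0" "u * v^3 * r3 \<noteq> 0" "u \<noteq> 0" "v \<noteq> 0" "p0 \<noteq> 0" "r0 \<noteq> 0"
      unfolding defs
        neg_equal_0_iff_equal mult_eq_0_iff power_eq_0_iff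
      using nz nonzero by simp_all
    show "smult (u * v * p1) (y1_poly 4 a b) = [:u^2 * p0, u * v * p1, v^2 * 0:]"
      by (simp add: y1_poly_def fraction_eq_simps nz; (intro conjI)?; unfold defs; algebra)
    show "smult (u * v^3 * r3) (y2_poly 4 a b) =
        [:u^4 * r0, u^3 * v * r1, u^2 * v^2 * r2, u * v^3 * r3, v^4 * 0:]"
      by (simp add: y2_poly_def fraction_eq_simps nz nonzero; (intro conjI)?; unfold defs; algebra)
    show "bethe_ode1 a [:u^2 * p0, u * v * p1, v^2 * 0:]
        [:u^4 * r0, u^3 * v * r1, u^2 * v^2 * r2, u * v^3 * r3, v^4 * 0:] =
      [:u^2 * p0, u * v * p1, v^2 * 0:] * [:u^3 * v * k0, u^2 * v^2 * k1, u * v^3 * k2, v^4 * 0:]"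
      by (rule bethe_ode1_factor; (simp; fail | unfold defs, algebra))
    show "bethe_ode2 b [:u^2 * p0, u * v * p1, v^2 * 0:]
        [:u^4 * r0, u^3 * v * r1, u^2 * v^2 * r2, u * v^3 * r3, v^4 * 0:] =
      [:u^4 * r0, u^3 * v * r1, u^2 * v^2 * r2, u * v^3 * r3, v^4 * 0:] * [:u * m0, v * m1, v^2 * 0:]"
      by (rule bethe_ode2_factor; (simp; fail | unfold defs, algebra))
    show "u^4 * r0 + u^3 * v * r1 + u^2 * v^2 * r2 + u * v^3 * r3 + v^4 * 0 \<noteq> 0"
      unfolding at_1 mult_eq_0_iff power_eq_0_iff using nz nonzero S_nz by simp
    show "1 = (0::nat) \<or> p1^2 - 4 * p0 * 0 \<noteq> 0"
      by (simp add: defs nz)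
    show "3 < (4::nat) \<or> r1 * r3 - 16 * r0 * 0 \<noteq> 0"
      by simp
  qed
qed

lemma represents_bethe_solution_5:
  fixes a b :: complex
  assumes ab: "a = pairing lam 1" "b = pairing lam 2"
    and nat: "a \<in> \<nat>" "b \<in> \<nat>" and nonzero: "a \<noteq> 0"
  shows "represents_bethe_solution [lam, fund_weight 2] [0, 1] (2, 3)
    (y1_poly 5 a b, y2_poly 5 a b)"
proof -
  define u where "u = 2*a+b+2"
  define v where "v = 2*a+b+3"
  define p0 where "p0 = a*(3*a+b+2)*(3*a+b+3)*(3*a+2*b+4)"
  define p1 where "p1 = - (2*(3*a+b+2)*(3*a+b+4)*(3*a^2 + 2*a*b + 6*a + b + 3))"
  define p2 where "p2 = (a+1)*(3*a+b+3)*(3*a+b+4)*(3*a+2*b+5)"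
  define r0 where "r0 = - ((3*a+b+2)*(3*a+b+3)*(3*a+2*b+4)^2)"
  define r1 where "r1 = 3*(3*a+b+2)*(3*a+2*b+4)*(9*a^2 + 9*a*b + 25*a + 2*b^2 + 12*b + 18)"
  define r2 where "r2 = - (3*(3*a+b+4)*(3*a+2*b+5)*(9*a^2 + 9*a*b + 20*a + 2*b^2 + 9*b + 11))"
  define r3 where "r3 = (3*a+b+3)*(3*a+b+4)*(3*a+2*b+5)^2"
  define k0 where "k0 = - (2*(3*a+b+2)*(3*a+b+4)*(3*a+2*b+4)*(3*a^2 + 2*a*b + 6*a + b + 3))"
  define k1 where "k1 = 2*(3*a+b+4)*(3*a+2*b+5)*(18*a^3 + 18*a^2*b + 63*a^2 + 4*a*b^2 + 41*a*b + 72*a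
      + 5*b^2 + 22*b + 27)"
  define k2 where "k2 = - (2*(a+2)*(3*a+b+3)*(3*a+b+4)*(3*a+2*b+5)^2)"
  define m0 where "m0 = - (3*b*a*(2*a+b+3)*(3*a+b+2)*(9*a^2 + 9*a*b + 25*a + 2*b^2 + 12*b + 18))"
  define m1 where "m1 = 6*(3*a+b+4)*(18*a^4*b + 45*a^4 + 27*a^3*b^2 + 142*a^3*b + 204*a^3 + 13*a^2*b^3
      + 109*a^2*b^2 + 330*a^2*b + 354*a^2 + 2*a*b^4 + 26*a*b^3 + 134*a*b^2 + 314*a*b
      + 276*a + b^4 + 12*b^3 + 54*b^2 + 108*b + 81)"
  define m2 where "m2 = - (3*(b+5)*(a+1)*(3*a+b+3)*(3*a+b+4)*(3*a+2*b+5))"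
  note defs = u_def v_def p0_def p1_def p2_def r0_def r1_def r2_def r3_def k0_def k1_def k2_def
    m0_def m1_def m2_def
  have nz: "a+1 \<noteq> 0" "2*a+b+2 \<noteq> 0" "2*a+b+3 \<noteq> 0" "3*a+b+2 \<noteq> 0"
    "3*a+b+3 \<noteq> 0" "3*a+b+4 \<noteq> 0" "3*a+2*b+4 \<noteq> 0" "3*a+2*b+5 \<noteq> 0"
    by (intro Nats_nonzero_intros nat)+
  define S where "S = 261*a^4 + 526*a^3*b + 1311*a^3 + 390*a^2*b^2 + 1959*a^2*b + 2463*a^2 + 126*a*b^3
      + 957*a*b^2 + 2424*a*b + 2049*a + 15*b^4 + 153*b^3 + 585*b^2 + 995*b + 636"
  have S_nz: "S \<noteq> 0"
    unfolding S_def by (intro Nats_nonzero_intros nat)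
  have at_1: "u^4 * r0 + u^3 * v * r1 + u^2 * v^2 * r2 + u * v^3 * r3 + v^4 * 0 = (2*a+b+2)*S"
    unfolding defs S_def by algebra
  define \<Delta> where "\<Delta> = 54*a^4 + 84*a^3*b + 234*a^3 + 48*a^2*b^2 + 270*a^2*b + 378*a^2 + 12*a*b^3
      + 102*a*b^2 + 288*a*b + 270*a + b^4 + 12*b^3 + 53*b^2 + 102*b + 72"
  have \<Delta>_nz: "\<Delta> \<noteq> 0"
    unfolding \<Delta>_def by (intro Nats_nonzero_intros nat)
  have disc: "p1^2 - 4 * p0 * p2 = 4*(3*a+b+2)*(3*a+b+4)*\<Delta>"
    unfolding defs \<Delta>_def by algebra
  show ?thesis
  proof (rule represents_bethe_solution_of_coeffs[OF ab])
    show "lead_coeff (y1_poly 5 a b) = 1" "lead_coeff (y2_poly 5 a b) = 1"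
      "degree (y1_poly 5 a b) = 2" "degree (y2_poly 5 a b) = 3" "3 \<le> (4::nat)"
      by (simp_all add: y1_poly_def y2_poly_def)
    show "v^2 * p2 \<noteq> 0" "u * v^3 * r3 \<noteq> 0" "u \<noteq> 0" "v \<noteq> 0" "p0 \<noteq> 0" "r0 \<noteq> 0"
      unfolding defs
        neg_equal_0_iff_equal mult_eq_0_iff power_eq_0_iff
      using nz nonzero by simp_all
    show "smult (v^2 * p2) (y1_poly 5 a b) = [:u^2 * p0, u * v * p1, v^2 * p2:]"
      by (simp add: y1_poly_def fraction_eq_simps nz; (intro conjI)?; unfold defs; algebra)
    show "smult (u * v^3 * r3) (y2_poly 5 a b) =
        [:u^4 * r0, u^3 * v * r1, u^2 * v^2 * r2, u * v^3 * r3, v^4 * 0:]"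
      by (simp add: y2_poly_def fraction_eq_simps nz nonzero; (intro conjI)?; unfold defs; algebra)
    show "bethe_ode1 a [:u^2 * p0, u * v * p1, v^2 * p2:]
        [:u^4 * r0, u^3 * v * r1, u^2 * v^2 * r2, u * v^3 * r3, v^4 * 0:] =
      [:u^2 * p0, u * v * p1, v^2 * p2:] * [:u^3 * v * k0, u^2 * v^2 * k1, u * v^3 * k2, v^4 * 0:]"
      by (rule bethe_ode1_factor; (simp; fail | unfold defs, algebra))
    show "bethe_ode2 b [:u^2 * p0, u * v * p1, v^2 * p2:]
        [:u^4 * r0, u^3 * v * r1, u^2 * v^2 * r2, u * v^3 * r3, v^4 * 0:] =
      [:u^4 * r0, u^3 * v * r1, u^2 * v^2 * r2, u * v^3 * r3, v^4 * 0:] * [:u * m0, v * m1, v^2 * m2:]"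
      by (rule bethe_ode2_factor; (simp; fail | unfold defs, algebra))
    show "u^4 * r0 + u^3 * v * r1 + u^2 * v^2 * r2 + u * v^3 * r3 + v^4 * 0 \<noteq> 0"
      unfolding at_1 mult_eq_0_iff power_eq_0_iff using nz nonzero S_nz by simp
    show "2 = (0::nat) \<or> p1^2 - 4 * p0 * p2 \<noteq> 0"
      unfolding disc mult_eq_0_iff power_eq_0_iff using nz \<Delta>_nz by simp
    show "3 < (4::nat) \<or> r1 * r3 - 16 * r0 * 0 \<noteq> 0"
      by simp
  qed
qed

lemma represents_bethe_solution_6:
  fixes a b :: complex
  assumes ab: "a = pairing lam 1" "b = pairing lam 2"
    and nat: "a \<in> \<nat>" "b \<in> \<nat>" and nonzero: "b \<noteq> 0"
  shows "represents_bethe_solution [lam, fund_weight 2] [0, 1] (2, 4)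
    (y1_poly 6 a b, y2_poly 6 a b)"
proof -
  \<comment> \<open>Each letter stands for a direction, its index for the constant term.\<close>
  define A1 where "A1 = a+b+1"
  define A2 where "A2 = a+b+2"
  define B2 where "B2 = 2*a+b+2"
  define B3 where "B3 = 2*a+b+3"
  define C3 where "C3 = 3*a+b+3"
  define C4 where "C4 = 3*a+b+4"
  define D3 where "D3 = 3*a+2*b+3"
  define D4 where "D4 = 3*a+2*b+4"
  define D5 where "D5 = 3*a+2*b+5"
  note linear = A1_def A2_def B2_def B3_def C3_def C4_def D3_def D4_def D5_def
  \<comment> \<open>The cofactor of a linear factor of \<open>y6_P3 a b\<close>.\<close>
  define T where "T = 12*a^3*b + 9*a^3 + 22*a^2*b^2 + 60*a^2*b + 38*a^2 + 12*a*b^3 + 62*a*b^2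
      + 102*a*b + 52*a + 2*b^4 + 16*b^3 + 46*b^2 + 56*b + 24"
  define u where "u = A1*B2"
  define v where "v = A2*B3"
  define p0 where "p0 = A2*C3*D3*D4"
  define p1 where "p1 = - (2*D3*D5*(3*a^2 + 4*a*b + 8*a + b^2 + 5*b + 6))"
  define p2 where "p2 = A1*C4*D4*D5"
  define r0 where "r0 = b*A2*B3*C3*D3^2*D4^2"
  define r1 where "r1 = - (2*D3^2*D4*D5*y6_P1 a b)"
  define r2 where "r2 = 6*D3*D5*y6_P2 a b"
  define r3 where "r3 = - (2*D3*D4*D5^2*T)"
  define r4 where "r4 = (b+1)*A1*B2*C4*D4^2*D5^2"
  define k0 where "k0 = 2*b*a*B3*D3^2*D4*D5*(3*a^2 + 4*a*b + 8*a + b^2 + 5*b + 6)"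
  define k1 where "k1 = - (2*D3*D5*(162*a^6*b + 54*a^6 + 513*a^5*b^2 + 1395*a^5*b + 504*a^5
      + 630*a^4*b^3 + 3408*a^4*b^2 + 5208*a^4*b + 1950*a^4 + 375*a^3*b^4
      + 3222*a^3*b^3 + 9306*a^3*b^2 + 10737*a^3*b + 4008*a^3 + 108*a^2*b^5
      + 1387*a^2*b^4 + 6284*a^2*b^3 + 13115*a^2*b^2 + 12790*a^2*b + 4620*a^2
      + 12*a*b^6 + 252*a*b^5 + 1718*a*b^4 + 5584*a*b^3 + 9550*a*b^2 + 8276*a*b
      + 2832*a + 12*b^6 + 144*b^5 + 720*b^4 + 1920*b^3 + 2868*b^2 + 2256*b + 720))"
  define k2 where "k2 = 2*(a+2)*D3*D4*D5^2*(18*a^3*b + 12*a^3 + 33*a^2*b^2 + 87*a^2*b + 54*a^2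
      + 18*a*b^3 + 92*a*b^2 + 150*a*b + 76*a + 3*b^4 + 24*b^3 + 69*b^2 + 84*b + 36)"
  define k3 where "k3 = - (2*(b+1)*(a+3)*A1*B2*C4*D4^2*D5^2)"
  define m0 where "m0 = - (2*A2*D3*D5*y6_P1 a b)"
  define m1 where "m1 = 2*A1*D5*(72*a^4*b + 153*a^4 + 180*a^3*b^2 + 774*a^3*b + 861*a^3 + 160*a^2*b^3
      + 1056*a^2*b^2 + 2390*a^2*b + 1854*a^2 + 60*a*b^4 + 544*a*b^3 + 1890*a*b^2
      + 2978*a*b + 1788*a + 8*b^5 + 94*b^4 + 448*b^3 + 1082*b^2 + 1320*b + 648)"
  define m2 where "m2 = - (4*(b+4)*A1*C4*D4*D5)"
  note defs = u_def v_def p0_def p1_def p2_def r0_def r1_def r2_def r3_def r4_def k0_def k1_def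
    k2_def k3_def m0_def m1_def m2_def linear T_def y6_P1_def y6_P2_def
  have nz: "b+1 \<noteq> 0" "A1 \<noteq> 0" "A2 \<noteq> 0" "B2 \<noteq> 0" "B3 \<noteq> 0"
    "C3 \<noteq> 0" "C4 \<noteq> 0" "D3 \<noteq> 0" "D4 \<noteq> 0" "D5 \<noteq> 0"
    unfolding linear by (intro Nats_nonzero_intros nat)+
  define S where "S = 783*a^8 + 7296*a^7*b + 9912*a^7 + 23708*a^6*b^2 + 74780*a^6*b + 54539*a^6
      + 39456*a^5*b^3 + 201432*a^5*b^2 + 330096*a^5*b + 170382*a^5 + 38328*a^4*b^4
      + 273936*a^4*b^3 + 718056*a^4*b^2 + 812328*a^4*b + 330600*a^4 + 22680*a^3*b^5
      + 210012*a^3*b^4 + 766344*a^3*b^3 + 1373104*a^3*b^2 + 1202092*a^3*b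
      + 408088*a^3 + 8064*a^2*b^6 + 92232*a^2*b^5 + 434688*a^2*b^4 + 1078896*a^2*b^3
      + 1483896*a^2*b^2 + 1068576*a^2*b + 313056*a^2 + 1584*a*b^7 + 21672*a*b^6
      + 125928*a*b^5 + 402552*a*b^4 + 763704*a*b^3 + 858384*a*b^2 + 527904*a*b
      + 136512*a + 132*b^8 + 2112*b^7 + 14664*b^6 + 57696*b^5 + 140628*b^4
      + 217248*b^3 + 207456*b^2 + 111744*b + 25920"
  have S_nz: "S \<noteq> 0"
    unfolding S_def by (intro Nats_nonzero_intros nat)
  have at_1: "u^4 * r0 + u^3 * v * r1 + u^2 * v^2 * r2 + u * v^3 * r3 + v^4 * r4 = A1*A2*B2*B3*S"
    unfolding defs S_def by algebra
  define \<Delta> where "\<Delta> = 54*a^4 + 132*a^3*b + 282*a^3 + 120*a^2*b^2 + 516*a^2*b + 552*a^2 + 48*a*b^3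
      + 312*a*b^2 + 672*a*b + 480*a + 7*b^4 + 62*b^3 + 203*b^2 + 292*b + 156"
  have \<Delta>_nz: "\<Delta> \<noteq> 0"
    unfolding \<Delta>_def by (intro Nats_nonzero_intros nat)
  have disc: "p1^2 - 4 * p0 * p2 = 4*D3*D5*\<Delta>"
    unfolding defs \<Delta>_def by algebra
  define F where "F = 81*a^8 + 792*a^7*b + 1044*a^7 + 2856*a^6*b^2 + 8400*a^6*b + 5835*a^6
      + 5184*a^5*b^3 + 24912*a^5*b^2 + 38052*a^5*b + 18468*a^5 + 5364*a^4*b^4
      + 36648*a^4*b^3 + 90528*a^4*b^2 + 95424*a^4*b + 36204*a^4 + 3312*a^3*b^5
      + 29736*a^3*b^4 + 103776*a^3*b^3 + 175368*a^3*b^2 + 143040*a^3*b + 45024*a^3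
      + 1208*a^2*b^6 + 13560*a^2*b^5 + 61948*a^2*b^4 + 147088*a^2*b^3
      + 190932*a^2*b^2 + 128144*a^2*b + 34704*a^2 + 240*a*b^7 + 3256*a*b^6
      + 18552*a*b^5 + 57464*a*b^4 + 104312*a*b^3 + 110736*a*b^2 + 63520*a*b
      + 15168*a + 20*b^8 + 320*b^7 + 2200*b^6 + 8480*b^5 + 20020*b^4 + 29600*b^3
      + 26720*b^2 + 13440*b + 2880"
  have F_nz: "F \<noteq> 0"
    unfolding F_def by (intro Nats_nonzero_intros nat)
  have quart: "r1 * r3 - 16 * r0 * r4 = 12*D3^2*D4^2*D5^2*F"
    unfolding defs F_def by algebra
  show ?thesis
  proof (rule represents_bethe_solution_of_coeffs[OF ab])
    show "lead_coeff (y1_poly 6 a b) = 1" "lead_coeff (y2_poly 6 a b) = 1"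
      "degree (y1_poly 6 a b) = 2" "degree (y2_poly 6 a b) = 4" "4 \<le> (4::nat)"
      by (simp_all add: y1_poly_def y2_poly_def)
    show "v^2 * p2 \<noteq> 0" "v^4 * r4 \<noteq> 0" "u \<noteq> 0" "v \<noteq> 0" "p0 \<noteq> 0" "r0 \<noteq> 0"
      unfolding u_def v_def p0_def p2_def r0_def r4_def
        neg_equal_0_iff_equal mult_eq_0_iff power_eq_0_iff
      using nz nonzero by simp_all
    have y1: "y1_poly 6 a b = [:A1 * B2^2 * C3 * D3 / (A2 * B3^2 * C4 * D5),
        - (2 * B2 * D3 * (3*a^2 + 4*a*b + b^2 + 8*a + 5*b + 6) / (A2 * B3 * C4 * D4)), 1:]"
      unfolding linear by (simp add: y1_poly_def)
    show "smult (v^2 * p2) (y1_poly 6 a b) = [:u^2 * p0, u * v * p1, v^2 * p2:]"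
      by (simp add: y1 fraction_eq_simps nz; (intro conjI)?;
          unfold u_def v_def p0_def p1_def p2_def; algebra)
    \<comment> \<open>The linear factors are kept as letters here, so that only monomials have to be compared.\<close>
    have P3: "y6_P3 a b = D3 * T" unfolding y6_P3_def linear T_def by algebra
    have y2: "y2_poly 6 a b = [:b * A1^3 * B2^3 * C3 * D3^2 / ((b+1) * A2^3 * B3^3 * C4 * D5^2),
        - (2 * A1^2 * B2^2 * D3^2 * y6_P1 a b / ((b+1) * A2^3 * B3^3 * C4 * D4 * D5)),
        6 * A1 * B2 * D3 * y6_P2 a b / ((b+1) * A2^2 * B3^2 * C4 * D4^2 * D5),
        - (2 * (D3 * T) / ((b+1) * A2 * B3 * C4 * D4)), 1:]"
      unfolding P3[symmetric] unfolding linear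
      by (simp add: y2_poly_def y6_c0_def y6_c1_def y6_c2_def y6_c3_def add_ac)
    show "smult (v^4 * r4) (y2_poly 6 a b) =
        [:u^4 * r0, u^3 * v * r1, u^2 * v^2 * r2, u * v^3 * r3, v^4 * r4:]"
      by (simp add: y2 fraction_eq_simps nz nonzero; (intro conjI)?;
          unfold u_def v_def r0_def r1_def r2_def r3_def r4_def; algebra)
    show "bethe_ode1 a [:u^2 * p0, u * v * p1, v^2 * p2:]
        [:u^4 * r0, u^3 * v * r1, u^2 * v^2 * r2, u * v^3 * r3, v^4 * r4:] =
      [:u^2 * p0, u * v * p1, v^2 * p2:] * [:u^3 * v * k0, u^2 * v^2 * k1, u * v^3 * k2, v^4 * k3:]"
      by (rule bethe_ode1_factor; (simp; fail | unfold defs, algebra))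
    show "bethe_ode2 b [:u^2 * p0, u * v * p1, v^2 * p2:]
        [:u^4 * r0, u^3 * v * r1, u^2 * v^2 * r2, u * v^3 * r3, v^4 * r4:] =
      [:u^4 * r0, u^3 * v * r1, u^2 * v^2 * r2, u * v^3 * r3, v^4 * r4:] * [:u * m0, v * m1, v^2 * m2:]"
      by (rule bethe_ode2_factor; (simp; fail | unfold defs, algebra))
    show "u^4 * r0 + u^3 * v * r1 + u^2 * v^2 * r2 + u * v^3 * r3 + v^4 * r4 \<noteq> 0"
      unfolding at_1 mult_eq_0_iff power_eq_0_iff using nz nonzero S_nz by simp
    show "2 = (0::nat) \<or> p1^2 - 4 * p0 * p2 \<noteq> 0"
      unfolding disc mult_eq_0_iff power_eq_0_iff using nz \<Delta>_nz by simp
    show "4 < (4::nat) \<or> r1 * r3 - 16 * r0 * r4 \<noteq> 0"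
      unfolding quart mult_eq_0_iff power_eq_0_iff using nz F_nz by simp
  qed
qed

section \<open>Highest weight modules\<close>

text \<open>Eigenvectors for different eigenvalues are independent; in this form it separates the levels of
  the grading of a highest weight module.\<close>

lemma (in vector_space) eigenvector_outside_spectrum:
  assumes x: "x \<in> span S" and T: "Vector_Spaces.linear scale scale T"
    and S: "\<And>s. s \<in> S \<Longrightarrow> \<exists>c. T s = scale c s \<and> c \<noteq> c0" and Tx: "T x = scale c0 x"
  shows "x = 0"
proof -
  interpret T: Vector_Spaces.linear scale scale T by fact
  obtain B where B: "B \<subseteq> S" "independent B" "S \<subseteq> span B"
    using maximal_independent_subset[of S] by blast
  have "x \<in> span B" using x B(3) span_mono[of S "span B"] by (simp add: span_span) blast
  then obtain t r where t: "finite t" "t \<subseteq> B" and x_eq: "x = (\<Sum>s\<in>t. scale (r s) s)"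
    by (auto simp: span_explicit)
  obtain c where c: "\<And>s. s \<in> S \<Longrightarrow> T s = scale (c s) s \<and> c s \<noteq> c0" using S by metis
  have "T x = (\<Sum>s\<in>t. scale (r s * c s) s)"
    unfolding x_eq T.sum using t B(1) c by (intro sum.cong) (auto simp: T.scale)
  moreover have "T x = (\<Sum>s\<in>t. scale (r s * c0) s)"
    unfolding Tx unfolding x_eq by (simp add: scale_sum_right mult.commute)
  ultimately have "(\<Sum>s\<in>t. scale (r s * c s - r s * c0) s) = 0"
    by (simp add: scale_left_diff_distrib sum_subtractf)
  then have "r s * c s - r s * c0 = 0" if "s \<in> t" for s
    using independentD[OF B(2) t, of "\<lambda>s. r s * c s - r s * c0"] that by simp
  then have "r s = 0" if "s \<in> t" for s
    using that c[of s] t(2) B(1) by fastforce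
  then show ?thesis unfolding x_eq by (simp add: sum.neutral)
qed

context lie_module
begin

lemma act_simps [simp]:
  "act x (u + v) = act x u + act x v" "act x (mscale c u) = mscale c (act x u)"
  "act (x + y) v = act x v + act y v" "act (scale c x) v = mscale c (act x v)"
  using act_linear_left[of v] act_linear_right[of x]
  by (simp_all add: linear_iff_vector_space vector_space_axioms M.vector_space_axioms)

lemma act_zero [simp]: "act x 0 = 0" "act 0 v = 0"
  using act_simps(2)[of x 0 0] act_simps(4)[of 0 0 v] by simp_all

lemma act_diff [simp]: "act x (u - w) = act x u - act x w"
  using act_simps(1)[of x "u - w" w] by (simp add: algebra_simps)

lemma act_swap: "act x (act y v) = act y (act x v) + act (bracket x y) v"
  by (simp add: act_bracket)

end

locale g2_module = g2_lie_algebra scale bracket e f h + lie_module scale bracket mscale act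
  for scale :: "complex \<Rightarrow> 'g::ab_group_add \<Rightarrow> 'g" and bracket and e f h :: "2 \<Rightarrow> 'g"
    and mscale :: "complex \<Rightarrow> 'v::ab_group_add \<Rightarrow> 'v" and act
begin

lemma act_ef: "act (e i) (act (f j) v) = act (f j) (act (e i) v) + (if i = j then act (h i) v else 0)"
  by (subst act_swap) (simp add: bracket_ef)

lemma act_hf: "act (h i) (act (f j) v) = act (f j) (act (h i) v) - mscale (pairing (simple_root j) i) (act (f j) v)"
  by (subst act_swap) (simp add: bracket_hf act_simps(4) del: scale_minus_left)

lemma act_he: "act (h i) (act (e j) v) = act (e j) (act (h i) v) + mscale (pairing (simple_root j) i) (act (e j) v)"
  by (subst act_swap) (simp add: bracket_he)

text \<open>The elements of the Lie algebra that preserve a subspace form a subalgebra.\<close>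

lemma stable_under_generators:
  assumes U: "M.subspace U" and "\<And>i u. u \<in> U \<Longrightarrow> act (e i) u \<in> U"
    and "\<And>i u. u \<in> U \<Longrightarrow> act (f i) u \<in> U" and "\<And>i u. u \<in> U \<Longrightarrow> act (h i) u \<in> U"
  shows "submodule_of mscale act U UNIV"
proof -
  let ?S = "{x. \<forall>u\<in>U. act x u \<in> U}"
  have "lie_subalgebra ?S"
    using U by (auto simp: lie_subalgebra_def subspace_def M.subspace_def act_bracket M.subspace_diff)
  then have "?S = UNIV" using assms by (intro generated) auto
  then show ?thesis using U by (auto simp: submodule_of_def)
qed

text \<open>The element of the Cartan subalgebra on which both simple roots take the value \<open>1\<close>. A single
  operator thus counts how many \<open>f\<^sub>i\<close> have been applied.\<close>

definition depth_element :: 'g where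
  "depth_element = scale 5 (h 1) + scale 3 (h 2)"

lemma simple_root_pairings:
  "pairing (simple_root 1) 1 = 2" "pairing (simple_root 2) 1 = -1"
  "pairing (simple_root 1) 2 = -3" "pairing (simple_root 2) 2 = 2"
  by (simp_all add: pairing_simple_root cartan_def)

lemma depth_f: "act depth_element (act (f i) x) = act (f i) (act depth_element x) - act (f i) x"
proof -
  have i: "i = 1 \<or> i = 2" by (rule exhaust_2)
  then have "5 * pairing (simple_root i) 1 + 3 * pairing (simple_root i) 2 = 1"
    by (auto simp: simple_root_pairings)
  then have "mscale 5 (mscale (pairing (simple_root i) 1) (act (f i) x))
      + mscale 3 (mscale (pairing (simple_root i) 2) (act (f i) x)) = act (f i) x"
    by (simp flip: M.scale_left_distrib)
  then show ?thesis
    by (simp add: depth_element_def act_hf M.scale_right_diff_distrib algebra_simps)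
qed

lemma linear_act: "Vector_Spaces.linear mscale mscale (act x)"
  by (rule act_linear_right)

end

locale g2_highest_weight_irrep = g2_module scale bracket e f h mscale act
  for scale :: "complex \<Rightarrow> 'g::ab_group_add \<Rightarrow> 'g" and bracket and e f h :: "2 \<Rightarrow> 'g"
    and mscale :: "complex \<Rightarrow> 'v::ab_group_add \<Rightarrow> 'v" and act +
  fixes lam :: weight and v :: 'v
  assumes irreducible: "irreducible_module mscale act"
    and hw_nonzero: "v \<noteq> 0"
    and e_hw: "act (e i) v = 0"
    and h_hw: "act (h i) v = mscale (pairing lam i) v"
begin

lemma submodule_trivial:
  assumes "M.subspace U" and "\<And>i u. u \<in> U \<Longrightarrow> act (e i) u \<in> U"
    and "\<And>i u. u \<in> U \<Longrightarrow> act (f i) u \<in> U" and "\<And>i u. u \<in> U \<Longrightarrow> act (h i) u \<in> U"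
  shows "U = {0} \<or> U = UNIV"
  using irreducible stable_under_generators[OF assms] by (simp add: irreducible_module_def)

inductive lowered :: "nat \<Rightarrow> 'v \<Rightarrow> bool" where
  hw: "lowered 0 v"
| lower: "lowered n x \<Longrightarrow> lowered (Suc n) (act (f i) x)"

lemma lowered_weight: "lowered n x \<Longrightarrow> \<exists>c. act (h i) x = mscale c x"
proof (induction rule: lowered.induct)
  case hw
  then show ?case using h_hw by blast
next
  case (lower n x j)
  then show ?case
    by (auto simp: act_hf simp flip: M.scale_left_diff_distrib)
qed

abbreviation "top_depth \<equiv> 5 * pairing lam 1 + 3 * pairing lam 2"

lemma lowered_depth: "lowered n x \<Longrightarrow> act depth_element x = mscale (top_depth - of_nat n) x"
proof (induction rule: lowered.induct)
  case hw
  then show ?case by (simp add: depth_element_def h_hw flip: M.scale_left_distrib)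
next
  case (lower n x i)
  have "act depth_element (act (f i) x) = mscale (top_depth - of_nat n - 1) (act (f i) x)"
    by (simp add: depth_f lower.IH M.scale_left_diff_distrib)
  then show ?case by (simp add: algebra_simps)
qed

lemma span_lowered: "M.span {x. \<exists>n. lowered n x} = UNIV"
proof -
  let ?L = "{x. \<exists>n. lowered n x}"
  have ind: "act y x \<in> M.span ?L" if "x \<in> M.span ?L" "\<And>n x. lowered n x \<Longrightarrow> act y x \<in> M.span ?L" for x y
    using that(1)
  proof (induction rule: M.span_induct_alt)
    case base
    then show ?case by (simp add: M.span_zero)
  next
    case (step c x y)
    then show ?case using that(2) by (auto intro!: M.span_add M.span_scale)
  qed
  have h: "act (h i) x \<in> M.span ?L" if "lowered n x" for i n x
  proof -
    have "x \<in> M.span ?L" using that by (intro M.span_base) auto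
    then show ?thesis using lowered_weight[OF that, of i] M.span_scale by metis
  qed
  have f: "act (f i) x \<in> M.span ?L" if "lowered n x" for i n x
    using lowered.lower[OF that] by (auto intro!: M.span_base)
  have e: "act (e i) x \<in> M.span ?L" if "lowered n x" for i n x
    using that
  proof (induction rule: lowered.induct)
    case hw
    then show ?case by (simp add: e_hw M.span_zero)
  next
    case (lower n x j)
    then show ?case using ind[OF lower.IH f] h[of n x] by (auto simp: act_ef intro!: M.span_add)
  qed
  have "M.span ?L = {0} \<or> M.span ?L = UNIV"
    by (rule submodule_trivial) (use ind e f h in auto)
  moreover have "v \<in> M.span ?L" by (intro M.span_base) (use hw in auto)
  ultimately show ?thesis using hw_nonzero by auto
qed

text \<open>A covector of weight \<open>\<lambda>\<close> exists because no nonempty word in the \<open>f\<^sub>i\<close> can lead back to the highest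
  weight vector: the eigenvalue of the depth element drops.\<close>

lemma hw_functional:
  "\<exists>\<phi>. Vector_Spaces.linear mscale (*) \<phi> \<and> \<phi> v = 1 \<and> (\<forall>i x. \<phi> (act (f i) x) = 0)"
proof -
  interpret C: vector_space "(*) :: complex \<Rightarrow> complex \<Rightarrow> complex" by (rule vector_space_times)
  interpret VC: vector_space_pair mscale "(*) :: complex \<Rightarrow> complex \<Rightarrow> complex" ..
  let ?S = "{x. \<exists>n. lowered (Suc n) x}"
  have "v \<notin> M.span ?S"
  proof
    assume "v \<in> M.span ?S"
    then have "v = 0"
    proof (rule M.eigenvector_outside_spectrum[OF _ linear_act[of depth_element]])
      show "act depth_element v = mscale top_depth v" using lowered_depth[OF hw] by simp
      show "\<exists>c. act depth_element s = mscale c s \<and> c \<noteq> top_depth" if "s \<in> ?S" for s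
        using that lowered_depth by (auto simp del: of_nat_Suc)
    qed
    with hw_nonzero show False by simp
  qed
  obtain B where B: "B \<subseteq> ?S" "M.independent B" "?S \<subseteq> M.span B"
    using M.maximal_independent_subset[of ?S] by blast
  have "v \<notin> M.span B" using \<open>v \<notin> M.span ?S\<close> M.span_mono[OF B(1)] by auto
  then have "M.independent (insert v B)" using B(2) by (rule M.independent_insertI)
  then obtain \<phi> where \<phi>: "Vector_Spaces.linear mscale (*) \<phi>"
    "\<And>b. b \<in> insert v B \<Longrightarrow> \<phi> b = (if b = v then 1 else 0)"
    using VC.linear_independent_extend[of "insert v B" "\<lambda>b. if b = v then 1 else 0"] by blast
  have "v \<notin> B" using \<open>v \<notin> M.span B\<close> M.span_base by blast
  interpret \<phi>: Vector_Spaces.linear mscale "(*) :: complex \<Rightarrow> complex \<Rightarrow> complex" \<phi> by fact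
  have "\<phi> b = 0" if "b \<in> B" for b using \<phi>(2)[of b] that \<open>v \<notin> B\<close> by auto
  then have 0: "\<phi> x = 0" if "x \<in> ?S" for x
    using \<phi>.eq_0_on_span[of B x] B(3) that by blast
  have "\<phi> (act (f i) x) = 0" for i x
  proof -
    have "x \<in> M.span {x. \<exists>n. lowered n x}" by (simp add: span_lowered)
    then show ?thesis
    proof (induction rule: M.span_induct_alt)
      case base
      then show ?case by (simp add: \<phi>.zero)
    next
      case (step c x y)
      then have "\<phi> (act (f i) x) = 0" by (intro 0) (auto intro: lowered.lower)
      with step show ?case by (simp add: \<phi>.add \<phi>.scale)
    qed
  qed
  moreover have "\<phi> v = 1" using \<phi>(2) by simp
  ultimately show ?thesis using \<phi>(1) by blast
qed

definition hw_coord :: "'v \<Rightarrow> complex" where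
  "hw_coord = (SOME \<phi>. Vector_Spaces.linear mscale (*) \<phi> \<and> \<phi> v = 1 \<and> (\<forall>i x. \<phi> (act (f i) x) = 0))"

lemma hw_coord:
  shows linear_hw_coord: "Vector_Spaces.linear mscale (*) hw_coord"
    and hw_coord_hw: "hw_coord v = 1" and hw_coord_f: "hw_coord (act (f i) x) = 0"
proof -
  from someI_ex[OF hw_functional, folded hw_coord_def]
  show "Vector_Spaces.linear mscale (*) hw_coord" "hw_coord v = 1" "hw_coord (act (f i) x) = 0"
    by simp_all
qed

sublocale hw_coord: Vector_Spaces.linear mscale "(*)" hw_coord
  by (rule linear_hw_coord)

lemma hw_coord_h: "hw_coord (act (h i) x) = pairing lam i * hw_coord x"
proof -
  have "x \<in> M.span {x. \<exists>n. lowered n x}" by (simp add: span_lowered)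
  then show ?thesis
  proof (induction rule: M.span_induct_alt)
    case base
    then show ?case by (simp add: hw_coord.zero)
  next
    case (step c x y)
    then obtain n where "lowered n x" by blast
    then have "hw_coord (act (h i) x) = pairing lam i * hw_coord x"
      by cases (simp_all add: h_hw act_hf hw_coord.scale hw_coord.diff hw_coord_f)
    with step show ?case by (simp add: hw_coord.add hw_coord.scale algebra_simps)
  qed
qed

text \<open>The right translates \<open>\<psi> \<circ> e\<^sub>i\<^sub>1 \<circ> \<dots> \<circ> e\<^sub>i\<^sub>n\<close> of the highest weight coordinate.\<close>

inductive raised_coord :: "('v \<Rightarrow> complex) \<Rightarrow> bool" where
  hw: "raised_coord hw_coord"
| raise: "raised_coord \<psi> \<Longrightarrow> raised_coord (\<lambda>x. \<psi> (act (e i) x))"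

lemma raised_coord_linear: "raised_coord \<psi> \<Longrightarrow> Vector_Spaces.linear mscale (*) \<psi>"
proof (induction rule: raised_coord.induct)
  case (raise \<psi> i)
  then show ?case
    by (simp add: linear_iff_vector_space M.vector_space_axioms vector_space_times)
qed (rule linear_hw_coord)

lemma raised_coord_h: "raised_coord \<psi> \<Longrightarrow> \<exists>c. \<forall>x. \<psi> (act (h i) x) = c * \<psi> x"
proof (induction rule: raised_coord.induct)
  case hw
  then show ?case using hw_coord_h by blast
next
  case (raise \<psi> j)
  interpret \<psi>: Vector_Spaces.linear mscale "(*)" \<psi> using raise(1) by (rule raised_coord_linear)
  obtain c where c: "\<And>x. \<psi> (act (h i) x) = c * \<psi> x" using raise by blast
  have "\<psi> (act (e j) (act (h i) x)) = (c - pairing (simple_root j) i) * \<psi> (act (e j) x)" for x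
  proof -
    have "\<psi> (act (h i) (act (e j) x))
        = \<psi> (act (e j) (act (h i) x)) + pairing (simple_root j) i * \<psi> (act (e j) x)"
      by (simp add: act_he \<psi>.add \<psi>.scale)
    then show ?thesis by (simp add: c algebra_simps)
  qed
  then show ?case by blast
qed

text \<open>The common kernel of the translates is a submodule, because each \<open>f\<^sub>j\<close> can be commuted to the left
  until it meets the highest weight coordinate, which annihilates it. By irreducibility this
  kernel vanishes, as it does not contain the highest weight vector.\<close>

lemma raised_coords_separate:
  assumes "\<And>\<psi>. raised_coord \<psi> \<Longrightarrow> \<psi> x = 0"
  shows "x = 0"
proof -
  let ?N = "{x. \<forall>\<psi>. raised_coord \<psi> \<longrightarrow> \<psi> x = 0}"
  have lin: "\<psi> 0 = 0" "\<psi> (x + y) = \<psi> x + \<psi> y" "\<psi> (mscale c x) = c * \<psi> x"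
    if "raised_coord \<psi>" for \<psi> x y c
  proof -
    interpret \<psi>: Vector_Spaces.linear mscale "(*)" \<psi> using that by (rule raised_coord_linear)
    show "\<psi> 0 = 0" "\<psi> (x + y) = \<psi> x + \<psi> y" "\<psi> (mscale c x) = c * \<psi> x"
      by (rule \<psi>.zero \<psi>.add \<psi>.scale)+
  qed
  have e: "act (e i) x \<in> ?N" if "x \<in> ?N" for i x
    using that raised_coord.raise by blast
  have h: "act (h i) x \<in> ?N" if "x \<in> ?N" for i x
  proof -
    have "\<psi> (act (h i) x) = 0" if "raised_coord \<psi>" for \<psi>
      using raised_coord_h[OF that, of i] that \<open>x \<in> ?N\<close> by auto
    then show ?thesis by blast
  qed
  have "\<psi> (act (f i) x) = 0" if "raised_coord \<psi>" "x \<in> ?N" for i x \<psi>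
    using that
  proof (induction arbitrary: x rule: raised_coord.induct)
    case hw
    then show ?case by (simp add: hw_coord_f)
  next
    case (raise \<psi> j)
    have "\<psi> (act (f i) (act (e j) x)) = 0" using raise.IH e[OF raise.prems] by blast
    moreover have "\<psi> (act (h j) x) = 0" using raise.hyps h[OF raise.prems] by blast
    ultimately show ?case using lin[OF raise.hyps] by (auto simp: act_ef)
  qed
  then have f: "act (f i) x \<in> ?N" if "x \<in> ?N" for i x using that by blast
  have "M.subspace ?N"
  proof (rule M.subspaceI)
    show "0 \<in> ?N" using lin(1) by blast
    show "x + y \<in> ?N" if "x \<in> ?N" "y \<in> ?N" for x y
      using that lin(2)[of _ x y] by fastforce
    show "mscale c x \<in> ?N" if "x \<in> ?N" for c x
      using that lin(3)[of _ c x] by fastforce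
  qed
  then have "?N = {0} \<or> ?N = UNIV"
    by (rule submodule_trivial) (use e f h in blast)+
  moreover have "v \<notin> ?N" using raised_coord.hw hw_coord_hw by force
  ultimately have "?N = {0}" by blast
  with assms show ?thesis by blast
qed

text \<open>Since the highest weight coordinate annihilates the image of every \<open>f\<^sub>i\<close>, this is the source of
  relations such as \<open>f\<^sub>i f\<^sub>j v = 0\<close> in an irreducible module: it suffices to apply \<open>e\<^sub>1\<close> and \<open>e\<^sub>2\<close>.\<close>

lemma singular_vector_zero:
  assumes "\<And>i. act (e i) x = 0" and "hw_coord x = 0"
  shows "x = 0"
proof (rule raised_coords_separate)
  fix \<psi> assume "raised_coord \<psi>"
  then show "\<psi> x = 0"
  proof cases
    case hw
    with assms(2) show ?thesis by simp
  next
    case (raise \<psi>' i)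
    interpret \<psi>': Vector_Spaces.linear mscale "(*)" \<psi>' using raise(2) by (rule raised_coord_linear)
    show ?thesis using raise(1) assms(1) by (simp add: \<psi>'.zero)
  qed
qed

text \<open>The dual of \<open>f\<^sub>i v = 0\<close>, and in the next lemma of \<open>f\<^sub>i\<^sup>2 v = 0\<close>.\<close>

lemma hw_coord_e:
  assumes "pairing lam i = 0"
  shows "hw_coord (act (e i) x) = 0"
proof -
  have "x \<in> M.span {x. \<exists>n. lowered n x}" by (simp add: span_lowered)
  then show ?thesis
  proof (induction rule: M.span_induct_alt)
    case base
    then show ?case by (simp add: hw_coord.zero)
  next
    case (step c x y)
    then obtain n where "lowered n x" by blast
    then have "hw_coord (act (e i) x) = 0"
    proof cases
      case (lower n x' j)
      then show ?thesis
        using assms by (auto simp: act_ef hw_coord.zero hw_coord.add hw_coord_f hw_coord_h)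
    qed (simp add: e_hw hw_coord.zero)
    with step show ?case by (simp add: hw_coord.add hw_coord.scale)
  qed
qed

lemma hw_coord_e_e:
  assumes "pairing lam i = 1"
  shows "hw_coord (act (e i) (act (e i) x)) = 0"
proof -
  have i: "pairing (simple_root i) i = 2" using exhaust_2[of i] by (auto simp: simple_root_pairings)
  have "x \<in> M.span {x. \<exists>n. lowered n x}" by (simp add: span_lowered)
  then show ?thesis
  proof (induction rule: M.span_induct_alt)
    case base
    then show ?case by (simp add: hw_coord.zero)
  next
    case (step c x y)
    then obtain n where "lowered n x" by blast
    then have "hw_coord (act (e i) (act (e i) x)) = 0"
    proof cases
      case (lower n x' j)
      have eh: "act (e i) (act (h i) x') = act (h i) (act (e i) x') - mscale 2 (act (e i) x')"
        by (simp add: act_he i)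
      show ?thesis
      proof (cases "j = i")
        case True
        then show ?thesis
          by (simp add: lower act_ef eh hw_coord.add hw_coord.diff hw_coord.scale hw_coord_f hw_coord_h assms)
      next
        case False
        then show ?thesis by (simp add: lower act_ef hw_coord_f)
      qed
    qed (simp add: e_hw hw_coord.zero)
    with step show ?case by (simp add: hw_coord.add hw_coord.scale)
  qed
qed

end

section \<open>The seven-dimensional module\<close>

text \<open>The weights of \<open>V\<^bsub>\<omega>\<^sub>2\<^esub>\<close> are the short roots and \<open>0\<close>, and they form a single chain under
  lowering, with arrows \<open>2, 1, 2, 2, 1, 2\<close>. The vector \<open>w k\<close> at depth \<open>k\<close> of this chain has the weight
  that belongs to \<open>\<^bold>l\<^sub>k\<close>.\<close>

locale g2_seven_dim = g2_highest_weight_irrep scale bracket e f h mscale act "fund_weight 2" v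
  for scale :: "complex \<Rightarrow> 'g::ab_group_add \<Rightarrow> 'g" and bracket and e f h :: "2 \<Rightarrow> 'g"
    and mscale :: "complex \<Rightarrow> 'v::ab_group_add \<Rightarrow> 'v" and act and v
begin

primrec w :: "nat \<Rightarrow> 'v" where
  "w 0 = v"
| "w (Suc k) = act (f (if k = 1 \<or> k = 4 then 1 else 2)) (w k)"

lemma w_steps:
  "act (f 2) (w 0) = w 1" "act (f 1) (w 1) = w 2" "act (f 2) (w 2) = w 3" "act (f 2) (w 3) = w 4"
  "act (f 1) (w 4) = w 5" "act (f 2) (w 5) = w 6"
  by (simp_all add: eval_nat_numeral)

lemma lowered_w: "lowered k (w k)"
proof (induction k)
  case 0
  show ?case by (simp add: lowered.hw)
next
  case (Suc k)
  then show ?case unfolding w.simps(2) by (rule lowered.lower)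
qed

lemma h_w:
  "act (h 1) (w 0) = 0 \<and> act (h 2) (w 0) = w 0"
  "act (h 1) (w 1) = w 1 \<and> act (h 2) (w 1) = - w 1"
  "act (h 1) (w 2) = - w 2 \<and> act (h 2) (w 2) = mscale 2 (w 2)"
  "act (h 1) (w 3) = 0 \<and> act (h 2) (w 3) = 0"
  "act (h 1) (w 4) = w 4 \<and> act (h 2) (w 4) = mscale (-2) (w 4)"
  "act (h 1) (w 5) = - w 5 \<and> act (h 2) (w 5) = w 5"
  "act (h 1) (w 6) = 0 \<and> act (h 2) (w 6) = - w 6"
proof -
  define wt where "wt x c1 c2 \<longleftrightarrow> act (h 1) x = mscale c1 x \<and> act (h 2) x = mscale c2 x" for x c1 c2
  have f1: "wt (act (f 1) x) (c1 - 2) (c2 + 3)" if "wt x c1 c2" for x c1 c2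
    using that by (simp add: wt_def act_hf simple_root_pairings M.scale_left_diff_distrib M.scale_left_distrib)
  have f2: "wt (act (f 2) x) (c1 + 1) (c2 - 2)" if "wt x c1 c2" for x c1 c2
    using that by (simp add: wt_def act_hf simple_root_pairings M.scale_left_diff_distrib M.scale_left_distrib)
  have 0: "wt (w 0) 0 1" using h_hw[of 1] h_hw[of 2] by (simp add: wt_def pairing_fund_weight)
  have 1: "wt (w 1) 1 (-1)" using f2[OF 0] unfolding w_steps by simp
  have 2: "wt (w 2) (-1) 2" using f1[OF 1] unfolding w_steps by simp
  have 3: "wt (w 3) 0 0" using f2[OF 2] unfolding w_steps by simp
  have 4: "wt (w 4) 1 (-2)" using f2[OF 3] unfolding w_steps by simp
  have 5: "wt (w 5) (-1) 1" using f1[OF 4] unfolding w_steps by simp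
  have 6: "wt (w 6) 0 (-1)" using f2[OF 5] unfolding w_steps by simp
  show "act (h 1) (w 0) = 0 \<and> act (h 2) (w 0) = w 0"
    "act (h 1) (w 1) = w 1 \<and> act (h 2) (w 1) = - w 1"
    "act (h 1) (w 2) = - w 2 \<and> act (h 2) (w 2) = mscale 2 (w 2)"
    "act (h 1) (w 3) = 0 \<and> act (h 2) (w 3) = 0"
    "act (h 1) (w 4) = w 4 \<and> act (h 2) (w 4) = mscale (-2) (w 4)"
    "act (h 1) (w 5) = - w 5 \<and> act (h 2) (w 5) = w 5"
    "act (h 1) (w 6) = 0 \<and> act (h 2) (w 6) = - w 6"
    using 0 1 2 3 4 5 6 unfolding wt_def by auto
qed

lemma f_vanishes:
  assumes "act (e 1) (act (f i) x) = 0" "act (e 2) (act (f i) x) = 0"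
  shows "act (f i) x = 0"
proof (rule singular_vector_zero)
  show "act (e j) (act (f i) x) = 0" for j
    using exhaust_2[of j] assms by auto
qed (rule hw_coord_f)

text \<open>Computed step by step down the chain: the action of the \<open>e\<^sub>i\<close> on \<open>w k\<close> follows from that on
  \<open>w (k - 1)\<close>, and the arrows missing from the chain vanish since their targets are singular.\<close>

lemma action_on_w:
  "act (e 1) (w 0) = 0" "act (e 2) (w 0) = 0" "act (f 1) (w 0) = 0"
  "act (e 1) (w 1) = 0" "act (e 2) (w 1) = w 0" "act (f 2) (w 1) = 0"
  "act (e 1) (w 2) = w 1" "act (e 2) (w 2) = 0" "act (f 1) (w 2) = 0"
  "act (e 1) (w 3) = 0" "act (e 2) (w 3) = mscale 2 (w 2)" "act (f 1) (w 3) = 0"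
  "act (e 1) (w 4) = 0" "act (e 2) (w 4) = mscale 2 (w 3)" "act (f 2) (w 4) = 0"
  "act (e 1) (w 5) = w 4" "act (e 2) (w 5) = 0" "act (f 1) (w 5) = 0"
  "act (e 1) (w 6) = 0" "act (e 2) (w 6) = w 5" "act (f 1) (w 6) = 0" "act (f 2) (w 6) = 0"
proof -
  have ef: "act (e 1) (act (f 1) x) = act (f 1) (act (e 1) x) + act (h 1) x"
    "act (e 2) (act (f 2) x) = act (f 2) (act (e 2) x) + act (h 2) x"
    "act (e 1) (act (f 2) x) = act (f 2) (act (e 1) x)"
    "act (e 2) (act (f 1) x) = act (f 1) (act (e 2) x)" for x
    by (simp_all add: act_ef)
  have [simp]: "act x (- y) = - act x y" for x y using act_diff[of x 0 y] by simp
  have double: "mscale 2 x = x + x" for x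
    using M.scale_left_distrib[of 1 1 x] by simp
  have e0: "act (e 1) (w 0) = 0" "act (e 2) (w 0) = 0" by (simp_all add: e_hw)
  have f0: "act (f 1) (w 0) = 0" by (rule f_vanishes) (simp_all add: ef e0 h_w del: w.simps)
  have e1: "act (e 1) (w 1) = 0" "act (e 2) (w 1) = w 0"
    unfolding w_steps(1)[symmetric] by (simp_all add: ef e0 f0 h_w del: w.simps)
  have f1: "act (f 2) (w 1) = 0" by (rule f_vanishes) (simp_all add: ef e1 f0 h_w w_steps(1) del: w.simps One_nat_def)
  have e2: "act (e 1) (w 2) = w 1" "act (e 2) (w 2) = 0"
    unfolding w_steps(2)[symmetric] by (simp_all add: ef e1 f0 h_w del: w.simps One_nat_def)
  have f2: "act (f 1) (w 2) = 0" by (rule f_vanishes) (simp_all add: ef e2 f1 h_w w_steps(2) del: w.simps One_nat_def)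
  have e3: "act (e 1) (w 3) = 0" "act (e 2) (w 3) = mscale 2 (w 2)"
    unfolding w_steps(3)[symmetric] by (simp_all add: ef e2 f1 h_w del: w.simps One_nat_def)
  have f3: "act (f 1) (w 3) = 0" by (rule f_vanishes) (simp_all add: ef e3 f2 h_w  del: w.simps One_nat_def)
  have e4: "act (e 1) (w 4) = 0" "act (e 2) (w 4) = mscale 2 (w 3)"
    unfolding w_steps(4)[symmetric] by (simp_all add: ef e3 f2 h_w w_steps(3) del: w.simps One_nat_def)
  have f4: "act (f 2) (w 4) = 0"
    by (rule f_vanishes) (simp_all add: ef e4 f3 h_w w_steps(4) double del: w.simps One_nat_def)
  have e5: "act (e 1) (w 5) = w 4" "act (e 2) (w 5) = 0"
    unfolding w_steps(5)[symmetric] by (simp_all add: ef e4 f3 h_w  del: w.simps One_nat_def)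
  have f5: "act (f 1) (w 5) = 0" by (rule f_vanishes) (simp_all add: ef e5 f4 h_w w_steps(5) del: w.simps One_nat_def)
  have e6: "act (e 1) (w 6) = 0" "act (e 2) (w 6) = w 5"
    unfolding w_steps(6)[symmetric] by (simp_all add: ef e5 f4 h_w  del: w.simps One_nat_def)
  have f6: "act (f 1) (w 6) = 0" by (rule f_vanishes) (simp_all add: ef e6 f5 h_w  del: w.simps One_nat_def)
  have f6': "act (f 2) (w 6) = 0" by (rule f_vanishes) (simp_all add: ef e6 f5 h_w w_steps(6) del: w.simps One_nat_def)
  show "act (e 1) (w 0) = 0" "act (e 2) (w 0) = 0" "act (f 1) (w 0) = 0"
    "act (e 1) (w 1) = 0" "act (e 2) (w 1) = w 0" "act (f 2) (w 1) = 0"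
    "act (e 1) (w 2) = w 1" "act (e 2) (w 2) = 0" "act (f 1) (w 2) = 0"
    "act (e 1) (w 3) = 0" "act (e 2) (w 3) = mscale 2 (w 2)" "act (f 1) (w 3) = 0"
    "act (e 1) (w 4) = 0" "act (e 2) (w 4) = mscale 2 (w 3)" "act (f 2) (w 4) = 0"
    "act (e 1) (w 5) = w 4" "act (e 2) (w 5) = 0" "act (f 1) (w 5) = 0"
    "act (e 1) (w 6) = 0" "act (e 2) (w 6) = w 5" "act (f 1) (w 6) = 0" "act (f 2) (w 6) = 0"
    by fact+
qed

lemma span_w: "M.span (w ` {..6}) = UNIV"
proof -
  let ?W = "M.span (w ` {..6})"
  have base: "w k \<in> ?W" if "k \<le> 6" for k using that by (intro M.span_base) auto
  have ind: "act y x \<in> ?W" if "x \<in> ?W" "\<And>k. k \<le> 6 \<Longrightarrow> act y (w k) \<in> ?W" for x y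
    using that(1)
  proof (induction rule: M.span_induct_alt)
    case base
    then show ?case by (simp add: M.span_zero)
  next
    case (step c x y)
    then show ?case using that(2) by (auto intro!: M.span_add M.span_scale)
  qed
  have cases: "k = 0 \<or> k = 1 \<or> k = 2 \<or> k = 3 \<or> k = 4 \<or> k = 5 \<or> k = 6" if "k \<le> 6" for k :: nat
    using that by linarith
  have gen: "act (e i) (w k) \<in> ?W \<and> act (f i) (w k) \<in> ?W \<and> act (h i) (w k) \<in> ?W" if "k \<le> 6" for i k
    using cases[OF that] exhaust_2[of i]
    by (elim disjE)
      (simp_all add: action_on_w w_steps h_w base M.span_zero M.span_scale M.span_neg del: w.simps One_nat_def)
  have "?W = {0} \<or> ?W = UNIV"
    by (rule submodule_trivial) (use ind gen in auto)
  moreover have "v \<in> ?W" using base[of 0] by simp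
  ultimately show ?thesis using hw_nonzero by auto
qed

text \<open>The seven depths are distinct, so the depth alone determines the weight space.\<close>

lemma eigenspace_of_depth:
  assumes x: "act depth_element x = mscale (3 - of_nat k) x" and "k \<le> 6"
  shows "\<exists>c. x = mscale c (w k)"
proof -
  have depth: "act depth_element (w j) = mscale (3 - of_nat j) (w j)" for j
    using lowered_depth[OF lowered_w[of j]] by (simp add: pairing_fund_weight)
  have "x \<in> M.span (insert (w k) (w ` ({..6} - {k})))"
    using span_w assms(2) by (simp add: insert_image image_insert[symmetric] insert_absorb del: image_insert)
  then obtain c where y: "x - mscale c (w k) \<in> M.span (w ` ({..6} - {k}))"
    by (auto simp: M.span_breakdown_eq)
  have "x - mscale c (w k) = 0"
    using y linear_act[of depth_element]
  proof (rule M.eigenvector_outside_spectrum[where ?c0.0 = "3 - of_nat k"])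
    show "act depth_element (x - mscale c (w k)) = mscale (3 - of_nat k) (x - mscale c (w k))"
      by (simp add: x depth M.scale_right_diff_distrib mult.commute)
    show "\<exists>c. act depth_element s = mscale c s \<and> c \<noteq> 3 - of_nat k" if "s \<in> w ` ({..6} - {k})" for s
      using that depth by auto
  qed
  then show ?thesis by auto
qed

text \<open>Every \<open>w k\<close> that vanished would make all later ones vanish, so a nonzero weight vector never runs
  into an accidental zero further up the chain.\<close>

lemma raising_injective:
  assumes x: "act depth_element x = mscale (3 - of_nat k) x" and "x \<noteq> 0"
  shows "k \<in> {1, 3, 4, 6} \<Longrightarrow> act (e 2) x \<noteq> 0"
    and "k \<in> {2, 5} \<Longrightarrow> act (e 1) x \<noteq> 0"
    and "k = 4 \<Longrightarrow> act (e 2) (act (e 2) x) \<noteq> 0"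
proof -
  have down: "w j \<noteq> 0" if "w k \<noteq> 0" "j \<le> k" for j k
    using that(2,1)
  proof (induction rule: dec_induct)
    case (step n)
    then have "w n \<noteq> 0" by auto
    with step show ?case by simp
  qed simp
  have *: "\<exists>c. x = mscale c (w k) \<and> c \<noteq> 0 \<and> w k \<noteq> 0" if "k \<le> 6"
    using eigenspace_of_depth[OF x that] \<open>x \<noteq> 0\<close> by auto
  show "k \<in> {1, 3, 4, 6} \<Longrightarrow> act (e 2) x \<noteq> 0"
    using * down[of k "k - 1"] by (auto simp: action_on_w simp del: w.simps One_nat_def)
  show "k \<in> {2, 5} \<Longrightarrow> act (e 1) x \<noteq> 0"
    using * down[of k "k - 1"] by (auto simp: action_on_w simp flip: One_nat_def simp del: w.simps One_nat_def)
  show "k = 4 \<Longrightarrow> act (e 2) (act (e 2) x) \<noteq> 0"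
    using * down[of k 2] by (auto simp: action_on_w simp del: w.simps One_nat_def)
qed

end

section \<open>Singular vectors in the tensor product\<close>

lemma pure_tensor_bilinear:
  assumes "vector_space sv" "vector_space sw"
  shows "pure_tensor sv sw (x + y) u = pure_tensor sv sw x u + pure_tensor sv sw y u"
    and "pure_tensor sv sw (sv c x) u = tscale c (pure_tensor sv sw x u)"
    and "pure_tensor sv sw x (u + u') = pure_tensor sv sw x u + pure_tensor sv sw x u'"
    and "pure_tensor sv sw x (sw c u) = tscale c (pure_tensor sv sw x u)"
  using bilinear_pure_tensor[OF assms] assms by (auto simp: bilinear_map_iff vector_space_tscale)

lemma tensor_expansion:
  assumes sv: "vector_space sv" and sw: "vector_space sw"
    and B: "finite B" "module.span sw B = UNIV" and T: "T \<in> tensor_space sv sw"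
  shows "\<exists>x. T = (\<Sum>k\<in>B. pure_tensor sv sw (x k) k)"
proof -
  interpret V: vector_space sv by fact
  interpret W: vector_space sw by fact
  interpret T: vector_space tscale by (rule vector_space_tscale)
  note pure = pure_tensor_bilinear[OF sv sw]
  let ?E = "{T. \<exists>x. T = (\<Sum>k\<in>B. pure_tensor sv sw (x k) k)}"
  have "T.subspace ?E"
  proof (rule T.subspaceI)
    have "pure_tensor sv sw 0 k = 0" for k
      using pure(2)[of 0 0 k] by (simp add: T.scale_zero_left)
    then have "0 = (\<Sum>k\<in>B. pure_tensor sv sw 0 k)" by simp
    then show "0 \<in> ?E" by (auto intro!: exI[of _ "\<lambda>k. 0"])
  next
    fix T T' assume "T \<in> ?E" "T' \<in> ?E"
    then obtain x x' where "T = (\<Sum>k\<in>B. pure_tensor sv sw (x k) k)" "T' = (\<Sum>k\<in>B. pure_tensor sv sw (x' k) k)"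
      by blast
    then have "T + T' = (\<Sum>k\<in>B. pure_tensor sv sw (x k + x' k) k)"
      by (simp add: pure sum.distrib)
    then show "T + T' \<in> ?E" by (auto intro!: exI[of _ "\<lambda>k. x k + x' k"])
  next
    fix c T assume "T \<in> ?E"
    then obtain x where "T = (\<Sum>k\<in>B. pure_tensor sv sw (x k) k)" by blast
    then have "tscale c T = (\<Sum>k\<in>B. pure_tensor sv sw (sv c (x k)) k)"
      by (simp add: pure T.scale_sum_right)
    then show "tscale c T \<in> ?E" by (auto intro!: exI[of _ "\<lambda>k. sv c (x k)"])
  qed
  moreover have "pure_tensor sv sw x u \<in> ?E" for x u
  proof -
    have "u \<in> W.span B" using B(2) by simp
    then obtain r where u: "u = (\<Sum>k\<in>B. sw (r k) k)"
      unfolding W.span_finite[OF B(1)] by blast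
    have "pure_tensor sv sw x (\<Sum>k\<in>C. sw (r k) k) = (\<Sum>k\<in>C. pure_tensor sv sw (sv (r k) x) k)"
      if "finite C" for C
      using that
    proof (induction C)
      case empty
      show ?case using pure(4)[of x 0 0] by (simp add: T.scale_zero_left)
    qed (simp add: pure)
    with B(1) u show ?thesis by (auto intro!: exI[of _ "\<lambda>k. sv (r k) x"])
  qed
  ultimately have "tensor_space sv sw \<subseteq> ?E"
    unfolding tensor_space_def by (intro T.span_minimal) auto
  with T show ?thesis by blast
qed

locale g2_tensor_seven_dim =
  V: g2_highest_weight_irrep scale bracket e f h sv av lam v +
  W: g2_seven_dim scale bracket e f h sw aw w0
  for scale :: "complex \<Rightarrow> 'g::ab_group_add \<Rightarrow> 'g" and bracket and e f h :: "2 \<Rightarrow> 'g"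
    and sv :: "complex \<Rightarrow> 'v::ab_group_add \<Rightarrow> 'v" and av and lam v
    and sw :: "complex \<Rightarrow> 'w::ab_group_add \<Rightarrow> 'w" and aw and w0
begin

abbreviation "tact \<equiv> tensor_act sv av sw aw"

lemma spaces: "vector_space sv" "vector_space sw"
  by unfold_locales

lemma modules: "lie_module scale bracket sv av" "lie_module scale bracket sw aw"
  by unfold_locales

text \<open>The map \<open>\<psi> \<otimes> id : V \<otimes> W \<rightarrow> W\<close>, provided by the universal property.\<close>

definition contract :: "('v \<Rightarrow> complex) \<Rightarrow> ('v, 'w) tensor \<Rightarrow> 'w" where
  "contract \<psi> = (SOME F. Vector_Spaces.linear tscale sw F \<and>
     (\<forall>x u. F (pure_tensor sv sw x u) = sw (\<psi> x) u))"

lemma bilinear_contraction: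
  assumes "Vector_Spaces.linear sv (*) \<psi>"
  shows "bilinear_map sv sw sw (\<lambda>x u. sw (\<psi> x) u)"
  using assms by (simp add: bilinear_map_iff spaces linear_iff_vector_space vector_space_times
      W.M.scale_left_distrib W.M.scale_right_distrib mult.commute)

lemma contract:
  assumes \<psi>: "Vector_Spaces.linear sv (*) \<psi>"
  shows linear_contract: "Vector_Spaces.linear tscale sw (contract \<psi>)"
    and contract_pure: "contract \<psi> (pure_tensor sv sw x u) = sw (\<psi> x) u"
proof -
  from someI_ex[OF tensor_universal(1)[OF spaces spaces(2) bilinear_contraction[OF \<psi>]], folded contract_def]
  show "Vector_Spaces.linear tscale sw (contract \<psi>)"
    "contract \<psi> (pure_tensor sv sw x u) = sw (\<psi> x) u"
    by simp_all
qed

text \<open>The Leibniz rule for the action on \<open>V \<otimes> W\<close>, read through \<open>\<psi> \<otimes> id\<close>.\<close>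

lemma contract_act:
  assumes \<psi>: "Vector_Spaces.linear sv (*) \<psi>" and T: "T \<in> tensor_space sv sw"
  shows "contract \<psi> (tact y T) = contract (\<lambda>x. \<psi> (av y x)) T + aw y (contract \<psi> T)"
proof -
  interpret F: Vector_Spaces.linear tscale sw "contract \<psi>" using \<psi> by (rule linear_contract)
  have \<psi>': "Vector_Spaces.linear sv (*) (\<lambda>x. \<psi> (av y x))"
    using \<psi> by (simp add: linear_iff_vector_space spaces vector_space_times)
  interpret F': Vector_Spaces.linear tscale sw "contract (\<lambda>x. \<psi> (av y x))" using \<psi>' by (rule linear_contract)
  interpret A: Vector_Spaces.linear tscale tscale "tact y" by (rule linear_tensor_act)
  have "bilinear_map sv sw sw (\<lambda>x u. sw (\<psi> (av y x)) u + sw (\<psi> x) (aw y u))"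
    using \<psi> \<psi>' by (simp add: bilinear_map_iff spaces linear_iff_vector_space vector_space_times
        W.M.scale_left_distrib W.M.scale_right_distrib mult.commute add_ac)
  moreover have "Vector_Spaces.linear tscale sw (\<lambda>T. contract \<psi> (tact y T))"
    by (simp add: linear_iff_vector_space vector_space_tscale spaces F.add F.scale A.add A.scale)
  moreover have "Vector_Spaces.linear tscale sw (\<lambda>T. contract (\<lambda>x. \<psi> (av y x)) T + aw y (contract \<psi> T))"
    by (simp add: linear_iff_vector_space vector_space_tscale spaces F.add F.scale F'.add F'.scale
        W.M.scale_right_distrib add_ac)
  ultimately show ?thesis
    by (rule tensor_universal(2)[OF spaces spaces(2) _ _ _ _ _ T])
      (simp_all add: tensor_act_pure[OF modules] F.add contract_pure[OF \<psi>] contract_pure[OF \<psi>'])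
qed

lemma contract_scale:
  assumes \<psi>: "Vector_Spaces.linear sv (*) \<psi>" and T: "T \<in> tensor_space sv sw"
  shows "contract (\<lambda>x. c * \<psi> x) T = sw c (contract \<psi> T)"
proof -
  interpret F: Vector_Spaces.linear tscale sw "contract \<psi>" using \<psi> by (rule linear_contract)
  have \<psi>': "Vector_Spaces.linear sv (*) (\<lambda>x. c * \<psi> x)"
    using \<psi> by (simp add: linear_iff_vector_space spaces vector_space_times distrib_left mult.left_commute)
  have "bilinear_map sv sw sw (\<lambda>x u. sw (c * \<psi> x) u)"
    using \<psi>' by (rule bilinear_contraction)
  moreover note linear_contract[OF \<psi>']
  moreover have "Vector_Spaces.linear tscale sw (\<lambda>T. sw c (contract \<psi> T))"
    by (simp add: linear_iff_vector_space vector_space_tscale spaces F.add F.scale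
        W.M.scale_right_distrib mult.commute)
  ultimately show ?thesis
    by (rule tensor_universal(2)[OF spaces spaces(2) _ _ _ _ _ T])
      (simp_all add: contract_pure[OF \<psi>] contract_pure[OF \<psi>'])
qed

text \<open>A basis of \<open>W\<close> turns \<open>T\<close> into a family of vectors of \<open>V\<close>, and these are separated by the translates.\<close>

lemma contractions_separate:
  assumes T: "T \<in> tensor_space sv sw"
    and zero: "\<And>\<psi>. V.raised_coord \<psi> \<Longrightarrow> contract \<psi> T = 0"
  shows "T = 0"
proof -
  interpret T: vector_space tscale by (rule vector_space_tscale)
  obtain B where B: "B \<subseteq> W.w ` {..6}" "W.M.independent B" "W.w ` {..6} \<subseteq> W.M.span B"
    using W.M.maximal_independent_subset by blast
  have fin: "finite B" using B(1) by (rule finite_subset) simp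
  have "W.M.span B = UNIV"
    using W.span_w W.M.span_mono[OF B(3)] by (simp add: W.M.span_span) blast
  from tensor_expansion[OF spaces fin this T]
  obtain x where x: "T = (\<Sum>k\<in>B. pure_tensor sv sw (x k) k)" by blast
  have "x k = 0" if "k \<in> B" for k
  proof (rule V.raised_coords_separate)
    fix \<psi> assume r: "V.raised_coord \<psi>"
    have lin: "Vector_Spaces.linear sv (*) \<psi>" by (rule V.raised_coord_linear[OF r])
    interpret F: Vector_Spaces.linear tscale sw "contract \<psi>" using lin by (rule linear_contract)
    have "(\<Sum>k\<in>B. sw (\<psi> (x k)) k) = contract \<psi> T"
      by (simp add: x F.sum contract_pure[OF lin])
    then have "(\<Sum>k\<in>B. sw (\<psi> (x k)) k) = 0" using zero[OF r] by simp
    then show "\<psi> (x k) = 0"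
      using W.M.independentD[OF B(2) fin order_refl, of "\<lambda>k. \<psi> (x k)"] that by blast
  qed
  moreover have "pure_tensor sv sw 0 k = 0" for k
    using pure_tensor_bilinear(2)[OF spaces, of 0 0 k] by (simp add: T.scale_zero_left)
  ultimately show ?thesis by (simp add: x)
qed

text \<open>For a singular tensor, contraction turns the translate of a covector by \<open>e\<^sub>i\<close> into the action of
  \<open>- e\<^sub>i\<close> on \<open>W\<close> (fact \<open>ce\<close> in the proof). So if the contraction with the highest weight coordinate
  vanished, all contractions with its translates would vanish and \<open>T\<close> would be \<open>0\<close>; and relations
  satisfied by the highest weight coordinate become relations for \<open>x\<close>.\<close>

lemma singular_tensor:
  assumes T: "T \<in> tensor_space sv sw" "T \<noteq> 0"
    and eT: "\<And>i. tact (e i) T = 0" and hT: "\<And>i. tact (h i) T = tscale (\<nu> i) T"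
  defines "x \<equiv> contract V.hw_coord T"
  shows "x \<noteq> 0" and "aw (h i) x = sw (\<nu> i - pairing lam i) x"
    and "pairing lam i = 0 \<Longrightarrow> aw (e i) x = 0"
    and "pairing lam i = 1 \<Longrightarrow> aw (e i) (aw (e i) x) = 0"
proof -
  have ce: "contract (\<lambda>x. \<psi> (av (e i) x)) T = - aw (e i) (contract \<psi> T)"
    if "Vector_Spaces.linear sv (*) \<psi>" for \<psi> i
  proof -
    interpret F: Vector_Spaces.linear tscale sw "contract \<psi>" using that by (rule linear_contract)
    have "contract \<psi> (tact (e i) T) = 0" by (simp add: eT F.zero)
    then show ?thesis unfolding contract_act[OF that T(1)] by (simp add: eq_neg_iff_add_eq_0)
  qed
  have neg: "aw y (- u) = - aw y u" for y u
    using W.act_diff[of y 0 u] by simp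
  show "x \<noteq> 0"
  proof
    assume "x = 0"
    have "contract \<psi> T = 0" if "V.raised_coord \<psi>" for \<psi>
      using that
    proof (induction rule: V.raised_coord.induct)
      case hw
      then show ?case using \<open>x = 0\<close> by (simp add: x_def)
    next
      case (raise \<psi> i)
      then show ?case by (simp add: ce[OF V.raised_coord_linear])
    qed
    then have "T = 0" by (rule contractions_separate[OF T(1)])
    with T(2) show False by simp
  qed
  note lin = V.linear_hw_coord
  have lin_e: "Vector_Spaces.linear sv (*) (\<lambda>x. V.hw_coord (av (e i) x))" for i
    using V.raised_coord_linear[OF V.raised_coord.raise[OF V.raised_coord.hw]] .
  have zero: "contract (\<lambda>x. 0) T = 0"
    using contract_scale[OF lin T(1), of 0] by simp
  show "aw (h i) x = sw (\<nu> i - pairing lam i) x"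
  proof -
    interpret F: Vector_Spaces.linear tscale sw "contract V.hw_coord" using lin by (rule linear_contract)
    have "sw (\<nu> i) x = contract V.hw_coord (tact (h i) T)" by (simp add: hT F.scale x_def)
    also have "\<dots> = sw (pairing lam i) x + aw (h i) x"
      unfolding contract_act[OF lin T(1)] by (simp add: V.hw_coord_h contract_scale[OF lin T(1)] x_def)
    finally show ?thesis by (simp add: W.M.scale_left_diff_distrib algebra_simps)
  qed
  show "aw (e i) x = 0" if "pairing lam i = 0"
    using ce[OF lin, of i] V.hw_coord_e[OF that] zero by (simp add: x_def)
  show "aw (e i) (aw (e i) x) = 0" if "pairing lam i = 1"
    using ce[OF lin_e[of i], of i] ce[OF lin, of i] V.hw_coord_e_e[OF that] zero
    by (simp add: x_def neg)
qed

end

lemma singular_tensor_of_embedding: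
  assumes U: "is_highest_weight_irrep sg bracket e h su au \<mu>"
    and V: "lie_module sg bracket sv av" and W: "lie_module sg bracket sw aw"
    and emb: "embeds_in_tensor su au sv av sw aw"
  obtains T where "T \<in> tensor_space sv sw" "T \<noteq> 0" "\<And>i. tensor_act sv av sw aw (e i) T = 0"
    "\<And>i. tensor_act sv av sw aw (h i) T = tscale (pairing \<mu> i) T"
proof -
  obtain u where u: "u \<noteq> 0" "\<And>i. au (e i) u = 0" "\<And>i. au (h i) u = su (pairing \<mu> i) u"
    using U unfolding is_highest_weight_irrep_def by blast
  obtain S \<phi> where S: "S \<subseteq> tensor_space sv sw" and lin: "Vector_Spaces.linear su tscale \<phi>"
    and bij: "bij_betw \<phi> UNIV S" and hom: "\<And>x u. \<phi> (au x u) = tensor_act sv av sw aw x (\<phi> u)"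
    using emb unfolding embeds_in_tensor_def submodule_of_def by blast
  interpret \<phi>: Vector_Spaces.linear su tscale \<phi> by fact
  have "\<phi> u \<in> tensor_space sv sw" using bij S unfolding bij_betw_def by blast
  moreover have "\<phi> u \<noteq> 0"
    using bij u(1) \<phi>.zero unfolding bij_betw_def inj_on_def by (metis UNIV_I)
  ultimately show ?thesis
    by (rule that) (simp_all add: hom[symmetric] u \<phi>.zero \<phi>.scale)
qed

text \<open>The contracted vector \<open>x\<close> lies at depth \<open>l\<^sub>1 + l\<^sub>2\<close> of the seven-dimensional module, where the relevant
  power of \<open>e\<^sub>i\<close> is injective.\<close>

lemma admissible_implies_bounds:
  assumes g2: "g2_lie_algebra sg bracket e f h"
    and V: "is_highest_weight_irrep sg bracket e h sv av lam"
    and W: "is_highest_weight_irrep sg bracket e h sw aw (fund_weight 2)"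
    and U: "is_highest_weight_irrep sg bracket e h su au
      (lam + fund_weight 2 - of_nat l1 *s simple_root 1 - of_nat l2 *s simple_root 2)"
    and emb: "embeds_in_tensor su au sv av sw aw"
  shows "l1 + l2 \<in> {1, 3, 4, 6} \<Longrightarrow> pairing lam 2 \<noteq> 0"
    and "l1 + l2 \<in> {2, 5} \<Longrightarrow> pairing lam 1 \<noteq> 0"
    and "l1 + l2 = 4 \<Longrightarrow> pairing lam 2 \<noteq> 1"
proof -
  obtain v where v: "v \<noteq> 0" "\<And>i. av (e i) v = 0" "\<And>i. av (h i) v = sv (pairing lam i) v"
    using V unfolding is_highest_weight_irrep_def by blast
  obtain w0 where w0: "w0 \<noteq> 0" "\<And>i. aw (e i) w0 = 0" "\<And>i. aw (h i) w0 = sw (pairing (fund_weight 2) i) w0"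
    using W unfolding is_highest_weight_irrep_def by blast
  interpret g2_lie_algebra sg bracket e f h by fact
  have mV: "lie_module sg bracket sv av" "irreducible_module sv av"
    and mW: "lie_module sg bracket sw aw" "irreducible_module sw aw"
    using V W unfolding is_highest_weight_irrep_def by auto
  interpret g2_tensor_seven_dim sg bracket e f h sv av lam v sw aw w0
    unfolding g2_tensor_seven_dim_def g2_seven_dim_def g2_highest_weight_irrep_def g2_module_def
      g2_highest_weight_irrep_axioms_def
    using g2 mV mW v w0 by blast
  define \<mu> where "\<mu> = lam + fund_weight 2 - of_nat l1 *s simple_root 1 - of_nat l2 *s simple_root 2"
  obtain T where T: "T \<in> tensor_space sv sw" "T \<noteq> 0" "\<And>i. tact (e i) T = 0"
    "\<And>i. tact (h i) T = tscale (pairing \<mu> i) T"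
    using singular_tensor_of_embedding[OF U mV(1) mW(1) emb] unfolding \<mu>_def by blast
  define x where "x = contract V.hw_coord T"
  note x = singular_tensor[OF T, folded x_def]
  have "5 * (pairing \<mu> 1 - pairing lam 1) + 3 * (pairing \<mu> 2 - pairing lam 2) = 3 - of_nat (l1 + l2)"
  proof -
    have "5 * (pairing \<mu> 1 - pairing lam 1) + 3 * (pairing \<mu> 2 - pairing lam 2)
        = 5 * pairing (fund_weight 2) 1 + 3 * pairing (fund_weight 2) 2 - of_nat (l1 + l2)"
      unfolding pairing_1 pairing_2 by (simp add: \<mu>_def simple_root_def axis_def algebra_simps)
    then show ?thesis by (simp add: pairing_fund_weight)
  qed
  then have depth: "aw W.depth_element x = sw (3 - of_nat (l1 + l2)) x"
    by (simp add: W.depth_element_def x(2) flip: W.M.scale_left_distrib)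
  show "l1 + l2 \<in> {1, 3, 4, 6} \<Longrightarrow> pairing lam 2 \<noteq> 0"
    using W.raising_injective(1)[OF depth x(1)] x(3) by blast
  show "l1 + l2 \<in> {2, 5} \<Longrightarrow> pairing lam 1 \<noteq> 0"
    using W.raising_injective(2)[OF depth x(1)] x(3) by blast
  show "l1 + l2 = 4 \<Longrightarrow> pairing lam 2 \<noteq> 1"
    using W.raising_injective(3)[OF depth x(1)] x(4) by blast
qed

section \<open>The theorem\<close>

lemma represents_bethe_solution_0:
  "represents_bethe_solution \<Lambda> z (0, 0) (y1_poly 0 a b, y2_poly 0 a b)"
  unfolding represents_bethe_solution_def bethe_solution_def
  by (intro exI[of _ "[]"]) (simp add: y1_poly_def y2_poly_def)

theorem theorem4p7:
  fixes sg :: "complex \<Rightarrow> 'g::ab_group_add \<Rightarrow> 'g"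
    and bracket :: "'g \<Rightarrow> 'g \<Rightarrow> 'g"
    and e f h :: "2 \<Rightarrow> 'g"
    and su :: "complex \<Rightarrow> 'u::ab_group_add \<Rightarrow> 'u" and au :: "'g \<Rightarrow> 'u \<Rightarrow> 'u"
    and sv :: "complex \<Rightarrow> 'v::ab_group_add \<Rightarrow> 'v" and av :: "'g \<Rightarrow> 'v \<Rightarrow> 'v"
    and sw :: "complex \<Rightarrow> 'w::ab_group_add \<Rightarrow> 'w" and aw :: "'g \<Rightarrow> 'w \<Rightarrow> 'w"
    and lam :: weight and a b :: complex and i l1 l2 :: nat
  assumes "g2_lie_algebra sg bracket e f h"
    and "dominant_integral lam"
    and "a = pairing lam 1" and "b = pairing lam 2"
    and "i \<in> {0..6}" and "l_vec i = (l1, l2)"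
    and "is_highest_weight_irrep sg bracket e h sv av lam"
    and "is_highest_weight_irrep sg bracket e h sw aw (fund_weight 2)"
    and "is_highest_weight_irrep sg bracket e h su au
           (lam + fund_weight 2 - of_nat l1 *s simple_root 1 - of_nat l2 *s simple_root 2)"
    and "embeds_in_tensor su au sv av sw aw"
  shows "represents_bethe_solution [lam, fund_weight 2] [0, 1] (l1, l2) (y1_poly i a b, y2_poly i a b)"
proof -
  \<comment> \<open>The index \<open>i\<close> of the pair equals \<open>l\<^sub>1 + l\<^sub>2\<close>, hence selects the bound that its pair needs.\<close>
  note bounds = admissible_implies_bounds[OF assms(1,7-10), folded assms(3,4)]
  have nat: "a \<in> \<nat>" "b \<in> \<nat>"
    using assms(2-4) by (auto simp: dominant_integral_def Nats_def)
  consider "i = 0" | "i = 1" | "i = 2" | "i = 3" | "i = 4" | "i = 5" | "i = 6"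
    using assms(5) by fastforce
  then show ?thesis
  proof cases
    assume "i = 0"
    then show ?thesis using assms(6) represents_bethe_solution_0 by (simp add: l_vec_def)
  next
    assume i: "i = 1"
    then have l: "l1 = 0" "l2 = 1" using assms(6) by (simp_all add: l_vec_def)
    show ?thesis unfolding i l
      using bounds l by (intro represents_bethe_solution_1 assms(3,4) nat) auto
  next
    assume i: "i = 2"
    then have l: "l1 = 1" "l2 = 1" using assms(6) by (simp_all add: l_vec_def)
    show ?thesis unfolding i l
      using bounds l by (intro represents_bethe_solution_2 assms(3,4) nat) auto
  next
    assume i: "i = 3"
    then have l: "l1 = 1" "l2 = 2" using assms(6) by (simp_all add: l_vec_def)
    show ?thesis unfolding i l
      using bounds l by (intro represents_bethe_solution_3 assms(3,4) nat) auto
  next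
    assume i: "i = 4"
    then have l: "l1 = 1" "l2 = 3" using assms(6) by (simp_all add: l_vec_def)
    show ?thesis unfolding i l
      using bounds l by (intro represents_bethe_solution_4 assms(3,4) nat) auto
  next
    assume i: "i = 5"
    then have l: "l1 = 2" "l2 = 3" using assms(6) by (simp_all add: l_vec_def)
    show ?thesis unfolding i l
      using bounds l by (intro represents_bethe_solution_5 assms(3,4) nat) auto
  next
    assume i: "i = 6"
    then have l: "l1 = 2" "l2 = 4" using assms(6) by (simp_all add: l_vec_def)
    show ?thesis unfolding i l
      using bounds l by (intro represents_bethe_solution_6 assms(3,4) nat) auto
  qed
qed

end
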